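(* Let $k\ge 1$ and let $\mathcal{P}=\{\{j_1^1,j_1^2\},\ldots,\{j_k^1,j_k^2\}\}$ be any pair partition of the set $[1,2k]=\{1,\ldots,2k\}$. For $S\subset[1,2k]$ let $a_{\mathcal{P}}(S)$ be the number of $\mathcal{P}$-augmented components in $S$ and $\delta_{\mathcal{P}}(S)$ the number of $\mathcal{P}$-deficient points in $S$, and consider the numbers $$v(S,l)=1-\frac{|S|+l}{|S|+a_{\mathcal{P}}(S)-\delta_{\mathcal{P}}(S)},\qquad l=0,1,2,\ldots,$$ for those $S$ such that the denominator is nonzero. Then the meromorphic continuation to $\mathbf{C}$ (in the variable $H$) of the hypergeometric integral $$L(\mathcal{P};H)=\int_{\Delta^{2k}[0,1]}\prod_{l=1}^k|s_{j_l^1}-s_{j_l^2}|^{2H-2}\,ds_1\cdots ds_{2k}$$ is holomorphic at all nonreal points and at all real points greater than the maximal value of $v(S,l)$ over all $l\ge 0$ and all subsets $S\subset[1,2k]$ such that the denominator is nonzero. In particular it is holomorphic at all real points greater than $1/2$, and the only possible poles in the interval $(0,1/2]$ are at those values $v(S,l)$ arising from the subsets $S\subset[1,2k]$ such that the number of $\mathcal{P}$-augmented components in $S$ exceeds the number of $\mathcal{P}$-deficient points in $S$.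
   Context: A pair partition of $\{1,\ldots,2k\}$ is a partition of this set into $k$ blocks of size two; two elements are paired by $\mathcal{P}$ if they form a block of $\mathcal{P}$. $\Delta^{2k}[0,1]=\{t\in\mathbf{R}^{2k}:0<t_1<\cdots<t_{2k}<1\}$. The integral $L(\mathcal{P};H)$ is initially defined for $\operatorname{Re}H>1/2$; its meromorphic continuation is the (unique) meromorphic function on $\mathbf{C}$ agreeing with it there. For natural numbers $a\le b$, $[a,b]=\{a,a+1,\ldots,b\}$; a subinterval of $[1,2k]$ is a set $[a,b]$ with $1\le a\le b\le 2k$. For a subinterval $I\subset[1,2k]$: $\operatorname{Aug}_{\mathcal{P}}(I)=I\cup\{p\}$ if the element $p=\min I-1$ immediately left adjacent to $I$ lies in $[1,2k]$ and is paired by $\mathcal{P}$ with an element of $I$; and $\operatorname{Aug}_{\mathcal{P}}(I)=I$ in all other cases. $\operatorname{Def}_{\mathcal{P}}(I)$ is the set of elements of $I$ which are not paired by $\mathcal{P}$ with elements of $\operatorname{Aug}_{\mathcal{P}}(I)$. The interval $I$ is called $\mathcal{P}$-augmented if $\operatorname{Aug}_{\mathcal{P}}(I)\neq I$. Every subset $S\subset[1,2k]$ decomposes uniquely as a union $S=\bigcup_{r=1}^sI_r$ of maximal subintervals (its components), i.e. for $r<\rho$ the right endpoint of $I_r$ is at least two less than the left endpoint of $I_\rho$. The number of $\mathcal{P}$-augmented components in $S$ is the number of $r$ such that $I_r$ is $\mathcal{P}$-augmented. The set of $\mathcal{P}$-deficient points of $S$ (also called $\mathcal{P}$-deficiencies)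 is $\bigcup_{r=1}^s\operatorname{Def}_{\mathcal{P}}(I_r)$. $|S|$ is the cardinality of $S$. *)

theory Defs
  imports "HOL-Complex_Analysis.Complex_Analysis"
begin

definition pair_partition :: "nat \<Rightarrow> nat set set \<Rightarrow> bool" where
  "pair_partition k P \<longleftrightarrow>
     partition_on {1..2*k} P \<and> card P = k \<and> (\<forall>B\<in>P. card B = 2)"

definition paired :: "nat set set \<Rightarrow> nat \<Rightarrow> nat \<Rightarrow> bool" where
  "paired P i j \<longleftrightarrow> {i, j} \<in> P"

definition subinterval :: "nat \<Rightarrow> nat set \<Rightarrow> bool" where
  "subinterval k I \<longleftrightarrow> (\<exists>a b. 1 \<le> a \<and> a \<le> b \<and> b \<le> 2*k \<and> I = {a..b})"

text \<open>If \<open>Min I = 1\<close>, then \<open>Min I - 1 = 0\<close> lies outside \<open>{1..2*k}\<close> and \<open>I\<close> is not augmented.\<close>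

definition Aug :: "nat \<Rightarrow> nat set set \<Rightarrow> nat set \<Rightarrow> nat set" where
  "Aug k P I =
     (if Min I - 1 \<in> {1..2*k} \<and> (\<exists>j\<in>I. paired P (Min I - 1) j)
      then insert (Min I - 1) I else I)"

definition Deficient :: "nat \<Rightarrow> nat set set \<Rightarrow> nat set \<Rightarrow> nat set" where
  "Deficient k P I = {i\<in>I. \<not> (\<exists>j\<in>Aug k P I. paired P i j)}"

definition augmented :: "nat \<Rightarrow> nat set set \<Rightarrow> nat set \<Rightarrow> bool" where
  "augmented k P I \<longleftrightarrow> Aug k P I \<noteq> I"

definition components_of_set :: "nat \<Rightarrow> nat set \<Rightarrow> nat set set" where
  "components_of_set k S =
     {I. subinterval k I \<and> I \<subseteq> S \<and>
         (\<forall>J. subinterval k J \<and> I \<subseteq> J \<and> J \<subseteq> S \<longrightarrow> J = I)}"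

definition num_augmented :: "nat \<Rightarrow> nat set set \<Rightarrow> nat set \<Rightarrow> nat" where
  "num_augmented k P S = card {I \<in> components_of_set k S. augmented k P I}"

definition num_deficient :: "nat \<Rightarrow> nat set set \<Rightarrow> nat set \<Rightarrow> nat" where
  "num_deficient k P S = card (\<Union>I\<in>components_of_set k S. Deficient k P I)"

definition v_denom :: "nat \<Rightarrow> nat set set \<Rightarrow> nat set \<Rightarrow> real" where
  "v_denom k P S =
     real (card S) + real (num_augmented k P S) - real (num_deficient k P S)"

definition v_val :: "nat \<Rightarrow> nat set set \<Rightarrow> nat set \<Rightarrow> nat \<Rightarrow> real" where
  "v_val k P S l = 1 - (real (card S) + real l) / v_denom k P S"

text \<open>The maximum exists: each denominator is nonnegative, so for fixed \<open>S\<close> the largest value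
  is the one at \<open>l = 0\<close>, and \<open>S = {1..2*k}\<close> has denominator \<open>2*k\<close>.\<close>

definition v_max :: "nat \<Rightarrow> nat set set \<Rightarrow> real" where
  "v_max k P =
     (GREATEST r. \<exists>S l. S \<subseteq> {1..2*k} \<and> v_denom k P S \<noteq> 0 \<and> r = v_val k P S l)"

text \<open>Points of \<open>\<real>\<^sup>m\<close> are extensional functions on \<open>{1..m}\<close>, with the product Lebesgue measure.\<close>

definition open_simplex :: "nat \<Rightarrow> (nat \<Rightarrow> real) set" where
  "open_simplex m =
     {t \<in> {1..m} \<rightarrow>\<^sub>E UNIV. (\<forall>i\<in>{1..m}. 0 < t i \<and> t i < 1) \<and> strict_mono_on {1..m} t}"

text \<open>The two elements of the \<open>l\<close>-th block are \<open>j1 l\<close> and \<open>j2 l\<close>.\<close>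

definition L_integral :: "nat \<Rightarrow> (nat \<Rightarrow> nat) \<Rightarrow> (nat \<Rightarrow> nat) \<Rightarrow> complex \<Rightarrow> complex" where
  "L_integral k j1 j2 H =
     (LINT s : open_simplex (2*k) | (\<Pi>\<^sub>M i\<in>{1..2*k}. lborel).
        (\<Prod>l=1..k. complex_of_real \<bar>s (j1 l) - s (j2 l)\<bar> powr (2*H - 2)))"

text \<open>Nice meromorphy excludes removable singularities and fixes the value 0 at poles, so that a
  continuation is unique as a function.\<close>

definition is_meromorphic_continuation ::
    "(complex \<Rightarrow> complex) \<Rightarrow> complex set \<Rightarrow> (complex \<Rightarrow> complex) \<Rightarrow> bool" where
  "is_meromorphic_continuation f D F \<longleftrightarrow>
     F nicely_meromorphic_on UNIV \<and> (\<forall>z\<in>D. F z = f z)"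

end

theory Submission
  imports Defs
begin

text \<open>
  In the gap coordinates \<open>u i = s i - s (i - 1)\<close> every factor \<open>\<bar>s j - s i\<bar>\<close> becomes a linear form
  \<open>u (i + 1) + \<dots> + u j\<close> with nonnegative coefficients, and the simplex becomes \<open>u > 0\<close>, \<open>\<Sum>u < 1\<close>.
  By homogeneity, replacing the cutoff \<open>\<Sum>u < 1\<close> by the weight \<open>exp (- \<Sum>u)\<close> multiplies the integral by
  a Gamma factor, whose reciprocal is entire.

  The integrals with weight \<open>exp (- \<Sum>u)\<close>, multiplied by monomials in the \<open>u i\<close> and by negative powers of
  the linear forms, satisfy identities obtained from the Euler fields \<open>\<Sum>i\<in>S. u i \<partial>/\<partial>u i\<close>.
  The identity for \<open>S\<close> divides by \<open>card S + l + s c\<close>, with \<open>s = 2 H - 2\<close> and \<open>c\<close> the number of linear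
  forms supported in \<open>S\<close>, and improves the order of vanishing \<open>l\<close> along \<open>S\<close>.
  Iterating yields integrals that converge on any given half plane, so the only poles are
  the zeros of these divisors. A count over the components of \<open>S\<close> gives \<open>v_denom S = 2 c\<close>, which
  identifies these zeros with the numbers \<open>v_val S l\<close>.
\<close>

section \<open>Holomorphic integrals and identity of meromorphic functions\<close>

text \<open>The forms vanish on overlapping coordinate subspaces, so their zero sets need not cross
  normally, and differentiating in a single variable does not reproduce the integral it started
  from. Summing over the coordinates in \<open>S\<close> does: a form supported in \<open>S\<close>
  meets all of its variables, and the quotients \<open>u i / form j\<close> with \<open>i\<close> in
  \<open>A j\<close> add up to 1. A form that sticks out of \<open>S\<close> leaves single quotients
  \<open>u i / form j\<close>. These lie between 0 and 1 and lower the order along no set, so the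
  orders can be raised one set at a time without resolving the singularities.

  The exponential weight removes the face where the gaps sum to 1; with the cutoff, integration by
  parts would leave boundary terms there. All identities are proved for \<open>Re s > -1\<close>,
  that is \<open>Re H > 1/2\<close>, where every integral involved converges: a set \<open>S\<close>
  contains at most \<open>card S\<close> of the supports \<open>A j\<close>, because the right
  endpoints of the pairs are distinct.\<close>

lemma norm_exp_minus_one_le: "norm (exp z - 1) \<le> norm z * exp (norm z)" for z :: complex
  using Taylor_exp_field[of z 0] by (simp add: mult.commute)

text \<open>Differentiation under the integral sign by dominated convergence. As \<open>g\<close>
  may take both signs, the difference quotients at \<open>s0\<close> are dominated by the integrands
  at two real points together, one on each side of \<open>Re s0\<close>.\<close>

lemma holomorphic_exp_integral:
  fixes f :: "'a \<Rightarrow> complex" and g :: "'a \<Rightarrow> real"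
  assumes [measurable]: "f \<in> borel_measurable M" "g \<in> borel_measurable M"
    and int: "\<And>\<sigma>::real. a < \<sigma> \<Longrightarrow> integrable M (\<lambda>x. f x * exp (of_real \<sigma> * of_real (g x)))"
  shows "(\<lambda>s. \<integral>x. f x * exp (s * of_real (g x)) \<partial>M) holomorphic_on {s. a < Re s}"
proof (rule holomorphic_onI)
  fix s0 assume "s0 \<in> {s. a < Re s}"
  hence s0: "a < Re s0" by simp
  have int': "integrable M (\<lambda>x. f x * exp (s * of_real (g x)))" if "a < Re s" for s
    by (rule Bochner_Integration.integrable_bound[OF int[OF that]]) (auto simp: norm_mult)
  \<comment> \<open>Of the \<open>2 * \<eta>\<close> in the dominating function, one
    \<open>\<eta>\<close> pays for the factor \<open>\<bar>g x\<bar>\<close> and one for the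
    increment \<open>h\<close>. A third of the distance keeps \<open>Re s0 - 2 * \<eta>\<close>
    above \<open>a\<close>.\<close>
  define \<eta> where "\<eta> = (Re s0 - a) / 3"
  have \<eta>: "\<eta> > 0" using s0 by (simp add: \<eta>_def)
  let ?F = "\<lambda>s. \<integral>x. f x * exp (s * of_real (g x)) \<partial>M"
  let ?D = "\<integral>x. f x * exp (s0 * of_real (g x)) * of_real (g x) \<partial>M"
  define w where "w = (\<lambda>x. (norm (f x * exp (of_real (Re s0 + 2*\<eta>) * of_real (g x)))
     + norm (f x * exp (of_real (Re s0 - 2*\<eta>) * of_real (g x)))) / \<eta>)"
  have w: "integrable M w"
    unfolding w_def using s0 \<eta>
    by (intro Bochner_Integration.integrable_divide Bochner_Integration.integrable_add
          Bochner_Integration.integrable_norm int) (auto simp: \<eta>_def field_simps)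
  have bound: "norm (f x * exp (s0 * of_real (g x)) * ((exp (h * of_real (g x)) - 1) / h)) \<le> w x"
    if h: "h \<noteq> 0" "norm h \<le> \<eta>" for h x
  proof -
    have "norm ((exp (h * of_real (g x)) - 1) / h) \<le> (norm h * \<bar>g x\<bar> * exp (norm h * \<bar>g x\<bar>)) / norm h"
      using norm_exp_minus_one_le[of "h * of_real (g x)"]
      unfolding norm_divide by (intro divide_right_mono) (auto simp: norm_mult)
    also have "\<dots> = \<bar>g x\<bar> * exp (norm h * \<bar>g x\<bar>)" using h by simp
    also have "\<dots> \<le> \<bar>g x\<bar> * exp (\<eta> * \<bar>g x\<bar>)"
      using h by (intro mult_left_mono) (auto intro: mult_right_mono)
    also have "\<dots> \<le> (exp (\<eta> * \<bar>g x\<bar>) / \<eta>) * exp (\<eta> * \<bar>g x\<bar>)"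
    proof (intro mult_right_mono)
      have "\<eta> * \<bar>g x\<bar> \<le> exp (\<eta> * \<bar>g x\<bar>)"
        using exp_ge_add_one_self[of "\<eta> * \<bar>g x\<bar>"] by linarith
      thus "\<bar>g x\<bar> \<le> exp (\<eta> * \<bar>g x\<bar>) / \<eta>" using \<eta> by (simp add: field_simps)
    qed auto
    also have "\<dots> = exp (2 * \<eta> * \<bar>g x\<bar>) / \<eta>" by (simp flip: exp_add)
    also have "\<dots> \<le> (exp (2 * \<eta> * g x) + exp (- (2 * \<eta> * g x))) / \<eta>"
      using \<eta> by (intro divide_right_mono) (auto simp: abs_if)
    finally have *: "norm ((exp (h * of_real (g x)) - 1) / h)
        \<le> (exp (2 * \<eta> * g x) + exp (- (2 * \<eta> * g x))) / \<eta>" .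
    have "norm (f x * exp (s0 * of_real (g x)) * ((exp (h * of_real (g x)) - 1) / h))
       \<le> norm (f x) * exp (Re s0 * g x) * ((exp (2 * \<eta> * g x) + exp (- (2 * \<eta> * g x))) / \<eta>)"
      using * unfolding norm_mult by (intro mult_mono) auto
    also have "\<dots> = w x" unfolding w_def
      unfolding norm_mult norm_exp_eq_Re
      by (simp add: distrib_left distrib_right left_diff_distrib add_divide_distrib mult.assoc flip: exp_add)
    finally show ?thesis .
  qed
  have "((\<lambda>h. (?F (s0 + h) - ?F s0) / h) \<longlongrightarrow> ?D) (at 0)"
    unfolding tendsto_at_iff_sequentially
  proof (intro allI impI)
    fix X :: "nat \<Rightarrow> complex" assume X: "\<forall>i. X i \<in> UNIV - {0}" "X \<longlonglongrightarrow> 0"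
    have "eventually (\<lambda>i. dist (X i) 0 < \<eta>) sequentially"
      using X(2) \<eta> by (rule tendstoD)
    then obtain n0 where n0: "\<And>i. i \<ge> n0 \<Longrightarrow> norm (X i) \<le> \<eta>"
      unfolding eventually_sequentially by (auto simp: dist_norm intro: less_imp_le)
    have "(\<lambda>i. \<integral>x. f x * exp (s0 * of_real (g x)) * ((exp (X (i+n0) * of_real (g x)) - 1) / X (i+n0)) \<partial>M)
        \<longlonglongrightarrow> ?D"
    proof (rule integral_dominated_convergence[where w = w])
      show "AE x in M. (\<lambda>i. f x * exp (s0 * of_real (g x)) * ((exp (X (i+n0) * of_real (g x)) - 1) / X (i+n0)))
               \<longlonglongrightarrow> f x * exp (s0 * of_real (g x)) * of_real (g x)"
      proof (intro AE_I2 tendsto_mult tendsto_const)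
        fix x
        have "((\<lambda>h. exp (h * of_real (g x))) has_field_derivative complex_of_real (g x)) (at 0)"
          by (auto intro!: derivative_eq_intros)
        hence "((\<lambda>h. (exp (h * of_real (g x)) - 1) / h) \<longlongrightarrow> complex_of_real (g x)) (at 0)"
          by (simp add: DERIV_def)
        moreover have "filterlim (\<lambda>i. X (i + n0)) (at 0) sequentially"
          using X LIMSEQ_ignore_initial_segment[OF X(2), of n0] by (auto simp: filterlim_at)
        ultimately show "(\<lambda>i. (exp (X (i+n0) * of_real (g x)) - 1) / X (i+n0)) \<longlonglongrightarrow> of_real (g x)"
          by (rule filterlim_compose)
      qed
      show "AE x in M. norm (f x * exp (s0 * of_real (g x)) *
          ((exp (X (i+n0) * of_real (g x)) - 1) / X (i+n0))) \<le> w x" for i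
        using X n0 bound by auto
    qed (use w in auto)
    moreover have "(\<integral>x. f x * exp (s0 * of_real (g x)) * ((exp (X (i+n0) * of_real (g x)) - 1) / X (i+n0)) \<partial>M)
       = (?F (s0 + X (i+n0)) - ?F s0) / X (i+n0)" for i
    proof -
      have "\<bar>Re (X (i+n0))\<bar> \<le> norm (X (i+n0))" by (rule abs_Re_le_cmod)
      hence "a < Re (s0 + X (i+n0))"
        using n0[of "i+n0"] \<eta> by (simp add: \<eta>_def field_simps)
      from int'[OF this] int'[OF s0]
      have "?F (s0 + X (i+n0)) - ?F s0
         = (\<integral>x. f x * exp ((s0 + X (i+n0)) * of_real (g x)) - f x * exp (s0 * of_real (g x)) \<partial>M)"
        by simp
      also have "\<dots> = (\<integral>x. X (i+n0) * (f x * exp (s0 * of_real (g x)) * ((exp (X (i+n0) * of_real (g x)) - 1) / X (i+n0))) \<partial>M)"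
        using X by (intro Bochner_Integration.integral_cong) (auto simp: distrib_right exp_add field_simps)
      finally show ?thesis using X by (simp add: mult.assoc)
    qed
    ultimately have "(\<lambda>i. ((\<lambda>h. (?F (s0 + h) - ?F s0) / h) \<circ> X) (i + n0)) \<longlonglongrightarrow> ?D"
      unfolding o_def by (simp only:)
    thus "((\<lambda>h. (?F (s0 + h) - ?F s0) / h) \<circ> X) \<longlonglongrightarrow> ?D"
      by (rule LIMSEQ_offset)
  qed
  hence "(?F has_field_derivative ?D) (at s0)" by (simp add: DERIV_def)
  thus "?F field_differentiable at s0 within {s. a < Re s}"
    using field_differentiable_at_within field_differentiable_def by blast
qed

text \<open>Peeling off the level sets of \<open>y\<close> one at a time, as in a layer-cake decomposition, reduces the
  inequality to the hypothesis on the sets \<open>S\<close>.\<close>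

lemma sum_weights_le_sum_max:
  fixes a :: "'i \<Rightarrow> real" and b :: "'j \<Rightarrow> real"
  assumes fin: "finite N" "finite K" and A: "\<And>j. j \<in> K \<Longrightarrow> A j \<subseteq> N" "\<And>j. j \<in> K \<Longrightarrow> A j \<noteq> {}"
    and b: "\<And>j. j \<in> K \<Longrightarrow> b j \<ge> 0"
    and ab: "\<And>S. S \<subseteq> N \<Longrightarrow> S \<noteq> {} \<Longrightarrow> (\<Sum>j | j \<in> K \<and> A j \<subseteq> S. b j) \<le> sum a S"
    and y: "\<And>i. i \<in> N \<Longrightarrow> y i \<le> 0" and m: "\<And>i j. j \<in> K \<Longrightarrow> i \<in> A j \<Longrightarrow> y i \<le> m j"
  shows "(\<Sum>i\<in>N. a i * y i) \<le> (\<Sum>j\<in>K. b j * m j)"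
  using y m
proof (induction "card {i\<in>N. y i < 0}" arbitrary: y m rule: less_induct)
  case less
  define S where "S = {i\<in>N. y i < 0}"
  have finS: "finite S" and SN: "S \<subseteq> N" using fin by (auto simp: S_def)
  show ?case
  proof (cases "S = {}")
    case True
    hence y0: "y i = 0" if "i \<in> N" for i using less.prems(1)[OF that] that by (auto simp: S_def)
    have "m j \<ge> 0" if "j \<in> K" for j
      using A[OF that] less.prems(2)[OF that] y0 by (metis ex_in_conv subsetD)
    thus ?thesis using y0 b by (simp add: sum_nonneg)
  next
    case False
    define t where "t = Max (y ` S)"
    have t: "t \<in> y ` S" unfolding t_def using False finS by (intro Max_in) auto
    have tge: "y i \<le> t" if "i \<in> S" for i unfolding t_def using that finS by (intro Max_ge) auto
    have t0: "t < 0" using t by (auto simp: S_def)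
    define y' where "y' = (\<lambda>i. if i \<in> S then y i - t else 0)"
    define m' where "m' = (\<lambda>j. if A j \<subseteq> S then m j - t else m j)"
    have y'0: "y' i \<le> 0" for i using tge by (auto simp: y'_def)
    have le: "(\<Sum>i\<in>N. a i * y' i) \<le> (\<Sum>j\<in>K. b j * m' j)"
    proof (rule less.hyps)
      have "{i \<in> N. y' i < 0} \<subset> S"
        using t by (auto simp: y'_def split: if_splits)
      thus "card {i \<in> N. y' i < 0} < card {i \<in> N. y i < 0}"
        unfolding S_def[symmetric] using finS by (rule psubset_card_mono[rotated])
      fix i j assume ij: "j \<in> K" "i \<in> A j"
      show "y' i \<le> m' j"
      proof (cases "A j \<subseteq> S")
        case True
        thus ?thesis using ij less.prems(2)[OF ij] by (auto simp: y'_def m'_def)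
      next
        case notsub: False
        \<comment> \<open>A form that is not supported in \<open>S\<close> has a coordinate with
          \<open>y = 0\<close>, so its bound \<open>m j\<close> is nonnegative and can stay
          unchanged.\<close>
        then obtain i' where i': "i' \<in> A j" "i' \<notin> S" by auto
        hence "y i' \<ge> 0" using A[OF ij(1)] by (auto simp: S_def not_less)
        with less.prems(2)[OF ij(1) i'(1)] have "m j \<ge> 0" by simp
        thus ?thesis using y'0[of i] notsub by (simp add: m'_def)
      qed
    qed (use y'0 in auto)
    have "y i = y' i + (if i \<in> S then t else 0)" if "i \<in> N" for i
      using that less.prems(1)[OF that] by (auto simp: y'_def S_def not_less)
    hence "(\<Sum>i\<in>N. a i * y i) = (\<Sum>i\<in>N. a i * y' i + t * (if i \<in> S then a i else 0))"
      by (intro sum.cong) (auto simp: algebra_simps)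
    also have "\<dots> = (\<Sum>i\<in>N. a i * y' i) + t * sum a S"
      using SN fin by (simp add: sum.distrib flip: sum_distrib_left)
        (simp add: sum.If_cases Int_absorb1)
    also have "\<dots> \<le> (\<Sum>j\<in>K. b j * m' j) + t * (\<Sum>j | j \<in> K \<and> A j \<subseteq> S. b j)"
      using le ab[OF SN False] t0 by (intro add_mono mult_left_mono_neg) auto
    also have "(\<Sum>j | j \<in> K \<and> A j \<subseteq> S. b j) = (\<Sum>j\<in>K. if A j \<subseteq> S then b j else 0)"
      using fin by (simp add: sum.If_cases Int_def)
    also have "(\<Sum>j\<in>K. b j * m' j) + t * \<dots> = (\<Sum>j\<in>K. b j * m j)"
      unfolding sum_distrib_left sum.distrib[symmetric]
      by (intro sum.cong) (auto simp: m'_def algebra_simps)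
    finally show ?thesis .
  qed
qed

text \<open>The difference, freed of removable singularities, vanishes near \<open>z0\<close> and
  hence on \<open>A\<close>; so around each point \<open>f\<close> and \<open>g\<close> agree except
  perhaps at the point itself. Niceness fixes the remaining value: 0 at a common pole, the limit
  elsewhere.\<close>

lemma nicely_meromorphic_identity:
  assumes f: "f nicely_meromorphic_on A" and g: "g nicely_meromorphic_on A"
    and A: "open A" "connected A" and U: "open U" "U \<subseteq> A" "z0 \<in> U"
    and eq: "\<And>z. z \<in> U \<Longrightarrow> f z = g z" and z: "z \<in> A"
  shows "f z = g z"
proof -
  let ?h = "\<lambda>z. f z - g z"
  have mero: "f meromorphic_on A" "g meromorphic_on A"
    using f g by (auto simp: nicely_meromorphic_on_def)
  hence h: "?h meromorphic_on A" by (intro meromorphic_intros)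
  hence nh: "remove_sings ?h nicely_meromorphic_on A" by (rule remove_sings_nicely_meromorphic)
  have ev: "eventually (\<lambda>w. remove_sings ?h w = ?h w) (at x)" if "x \<in> A" for x
    using meromorphic_on_isolated_singularity[of ?h x] meromorphic_on_subset[OF h, of "{x}"] that
    by (intro eventually_remove_sings_eq_at) auto
  have "eventually (\<lambda>w. w \<in> U) (at z0)" using U by (auto simp: eventually_at_topological)
  moreover have "eventually (\<lambda>w. remove_sings ?h w = ?h w) (at z0)" using ev U by blast
  ultimately have "eventually (\<lambda>w. remove_sings ?h w = 0) (at z0)"
    by eventually_elim (use eq in auto)
  hence fr: "frequently (\<lambda>w. remove_sings ?h w = 0) (at z0)"
    by (intro eventually_frequently) auto
  have zero: "remove_sings ?h w = 0" if "w \<in> A" for w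
    using frequently_eq_meromorphic_imp_constant[OF fr nh A] U that by auto
  have "eventually (\<lambda>w. w \<in> A) (at z)" using A z by (auto simp: eventually_at_topological)
  with ev[OF z] have fg: "eventually (\<lambda>w. f w = g w) (at z)"
    by eventually_elim (use zero in auto)
  have pole: "is_pole f z \<longleftrightarrow> is_pole g z" by (rule is_pole_cong) (use fg in auto)
  show ?thesis
  proof (cases "is_pole f z")
    case True
    moreover have "\<not> h \<midarrow>z\<rightarrow> c" if "is_pole h z" for h c
      using that not_tendsto_and_filterlim_at_infinity[of "at z" h c] by (auto simp: is_pole_def)
    ultimately have "f z = 0" "g z = 0"
      using pole f g z unfolding nicely_meromorphic_on_def by blast+
    thus ?thesis by simp
  next
    case False
    hence "isCont f z" "isCont g z"
      using pole nicely_meromorphic_on_imp_analytic_at[OF f z] nicely_meromorphic_on_imp_analytic_at[OF g z]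
      by (auto intro: analytic_at_imp_isCont)
    hence "f \<midarrow>z\<rightarrow> f z" "g \<midarrow>z\<rightarrow> g z" by (auto simp: isCont_def)
    thus ?thesis using fg tendsto_cong[OF fg] tendsto_unique[of "at z"] by (metis at_neq_bot)
  qed
qed

section \<open>Shears and dilations of product Lebesgue measure\<close>

interpretation lborel_product: product_sigma_finite "\<lambda>_. lborel :: real measure"
  by (rule product_sigma_finite.intro) (rule sigma_finite_lborel)

text \<open>The convention \<open>s 0 = 0\<close> is built in by the case distinction, since index 0
  lies outside the domain of the extensional function \<open>s\<close>.\<close>

definition gaps :: "nat \<Rightarrow> (nat \<Rightarrow> real) \<Rightarrow> nat \<Rightarrow> real" where
  "gaps n s = (\<lambda>i\<in>{1..n}. s i - (if i = 1 then 0 else s (i - 1)))"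

lemma gaps_measurable [measurable]:
  "gaps n \<in> PiM {1..n} (\<lambda>_. lborel) \<rightarrow>\<^sub>M PiM {1..n} (\<lambda>_. lborel)"
  unfolding gaps_def
proof (rule measurable_restrict)
  fix i assume i: "i \<in> {1..n}"
  show "(\<lambda>s. s i - (if i = 1 then 0 else s (i - 1))) \<in> PiM {1..n} (\<lambda>_. lborel) \<rightarrow>\<^sub>M lborel"
  proof (cases "i = 1")
    case False
    hence "i - 1 \<in> {1..n}" using i by auto
    with i False show ?thesis by (simp) measurable
  qed (use i in simp)
qed

text \<open>The map is triangular with unit diagonal: with the earlier coordinates fixed, the last
  gap is a translate of the last coordinate, so induction over the coordinates reduces to
  translation invariance on the line.\<close>

lemma nn_integral_gaps:
  assumes "f \<in> borel_measurable (PiM {1..n} (\<lambda>_. lborel))"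
  shows "(\<integral>\<^sup>+s. f (gaps n s) \<partial>PiM {1..n} (\<lambda>_. lborel)) = (\<integral>\<^sup>+s. f s \<partial>PiM {1..n} (\<lambda>_. lborel))"
  using assms
proof (induction n arbitrary: f)
  case 0
  have "gaps 0 s = (\<lambda>_. undefined)" for s by (auto simp: gaps_def)
  thus ?case by (simp add: PiM_empty nn_integral_count_space_finite)
next
  case (Suc n)
  let ?I = "{1..n}"
  let ?P = "PiM ?I (\<lambda>_. lborel :: real measure)"
  have I: "{1..Suc n} = insert (Suc n) ?I" by auto
  note [measurable] = Suc.prems[unfolded I]
  have m: "(\<lambda>s. f (gaps (Suc n) s)) \<in> borel_measurable (PiM {1..Suc n} (\<lambda>_. lborel))"
    using Suc.prems by measurable
  have upd: "gaps (Suc n) (x(Suc n := y)) = (gaps n x)(Suc n := - (if n = 0 then 0 else x n) + 1 * y)" for x y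
    by (auto simp: gaps_def fun_eq_iff restrict_def)
  have m2: "(\<lambda>p. f ((fst p)(Suc n := snd p))) \<in> borel_measurable (?P \<Otimes>\<^sub>M lborel)"
    by measurable
  have "(\<integral>\<^sup>+s. f (gaps (Suc n) s) \<partial>PiM {1..Suc n} (\<lambda>_. lborel))
     = (\<integral>\<^sup>+x. \<integral>\<^sup>+y. f (gaps (Suc n) (x(Suc n := y))) \<partial>lborel \<partial>?P)"
    using m unfolding I by (subst lborel_product.product_nn_integral_insert) auto
  also have "\<dots> = (\<integral>\<^sup>+x. \<integral>\<^sup>+y. f ((gaps n x)(Suc n := y)) \<partial>lborel \<partial>?P)"
  proof (rule nn_integral_cong)
    fix x assume x: "x \<in> space ?P"
    have gx: "gaps n x \<in> space ?P" using gaps_measurable x by (rule measurable_space)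
    have [measurable]: "(\<lambda>y. f ((gaps n x)(Suc n := y))) \<in> borel_measurable borel"
      using measurable_Pair2[OF m2 gx] by simp
    show "(\<integral>\<^sup>+y. f (gaps (Suc n) (x(Suc n := y))) \<partial>lborel) = (\<integral>\<^sup>+y. f ((gaps n x)(Suc n := y)) \<partial>lborel)"
      using nn_integral_real_affine[of "\<lambda>y. f ((gaps n x)(Suc n := y))" 1 "- (if n = 0 then 0 else x n)"]
      unfolding upd by simp
  qed
  also have "\<dots> = (\<integral>\<^sup>+x. \<integral>\<^sup>+y. f (x(Suc n := y)) \<partial>lborel \<partial>?P)"
  proof (rule Suc.IH)
    show "(\<lambda>x. \<integral>\<^sup>+y. f (x(Suc n := y)) \<partial>lborel) \<in> borel_measurable ?P"
      using m2 by (intro lborel.borel_measurable_nn_integral) (simp add: case_prod_unfold)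
  qed
  also have "\<dots> = (\<integral>\<^sup>+s. f s \<partial>PiM {1..Suc n} (\<lambda>_. lborel))"
    unfolding I
    by (subst lborel_product.product_nn_integral_insert) (use Suc.prems[unfolded I] in auto)
  finally show ?case .
qed

lemma distr_gaps:
  "distr (PiM {1..n} (\<lambda>_. lborel)) (PiM {1..n} (\<lambda>_. lborel)) (gaps n) = PiM {1..n} (\<lambda>_. lborel)"
proof (rule measure_eqI)
  fix B assume B: "B \<in> sets (distr (PiM {1..n} (\<lambda>_. lborel)) (PiM {1..n} (\<lambda>_. lborel)) (gaps n))"
  hence [measurable]: "B \<in> sets (PiM {1..n} (\<lambda>_. lborel))" by simp
  have "emeasure (distr (PiM {1..n} (\<lambda>_. lborel)) (PiM {1..n} (\<lambda>_. lborel)) (gaps n)) B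
     = (\<integral>\<^sup>+s. indicator B (gaps n s) \<partial>PiM {1..n} (\<lambda>_. lborel))"
    unfolding nn_integral_indicator[OF B, symmetric]
    by (rule nn_integral_distr[OF gaps_measurable borel_measurable_indicator[OF B]])
  also have "\<dots> = emeasure (PiM {1..n} (\<lambda>_. lborel)) B"
    using nn_integral_gaps[of "indicator B" n] B by (simp del: One_nat_def)
  finally show "emeasure (distr (PiM {1..n} (\<lambda>_. lborel)) (PiM {1..n} (\<lambda>_. lborel)) (gaps n)) B
     = emeasure (PiM {1..n} (\<lambda>_. lborel)) B" .
qed simp

lemma integral_gaps:
  fixes f :: "(nat \<Rightarrow> real) \<Rightarrow> 'a :: {banach, second_countable_topology}"
  assumes "f \<in> borel_measurable (PiM {1..n} (\<lambda>_. lborel))"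
  shows "(\<integral>s. f (gaps n s) \<partial>PiM {1..n} (\<lambda>_. lborel)) = (\<integral>u. f u \<partial>PiM {1..n} (\<lambda>_. lborel))"
  by (subst (2) distr_gaps[symmetric], subst integral_distr) (use assms in \<open>auto simp del: One_nat_def\<close>)

definition scale_fun :: "'i set \<Rightarrow> real \<Rightarrow> ('i \<Rightarrow> real) \<Rightarrow> 'i \<Rightarrow> real" where
  "scale_fun N c u = (\<lambda>i\<in>N. c * u i)"

lemma scale_fun_measurable [measurable]:
  "scale_fun N c \<in> PiM N (\<lambda>_. lborel) \<rightarrow>\<^sub>M PiM N (\<lambda>_. lborel)"
  unfolding scale_fun_def by (rule measurable_restrict) simp

lemma nn_integral_scale_fun:
  assumes "finite N" "c > 0" "f \<in> borel_measurable (PiM N (\<lambda>_. lborel))"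
  shows "(\<integral>\<^sup>+u. f u \<partial>PiM N (\<lambda>_. lborel))
    = ennreal (c ^ card N) * (\<integral>\<^sup>+u. f (scale_fun N c u) \<partial>PiM N (\<lambda>_. lborel))"
  using assms(1,3)
proof (induction N arbitrary: f rule: finite_induct)
  case empty
  have "scale_fun {} c s = (\<lambda>_. undefined)" for s :: "'a \<Rightarrow> real" by (auto simp: scale_fun_def)
  thus ?case by (simp add: PiM_empty nn_integral_count_space_finite)
next
  case (insert i N)
  note [measurable] = insert.prems
  let ?P = "PiM N (\<lambda>_. lborel :: real measure)"
  have upd: "scale_fun (insert i N) c (x(i := y)) = (scale_fun N c x)(i := 0 + c * y)" for x y
    using insert.hyps by (auto simp: scale_fun_def fun_eq_iff restrict_def)
  have m2: "(\<lambda>p. f ((fst p)(i := snd p))) \<in> borel_measurable (?P \<Otimes>\<^sub>M lborel)"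
    by measurable
  have m3: "(\<lambda>x. \<integral>\<^sup>+y. f (x(i := y)) \<partial>lborel) \<in> borel_measurable ?P"
    using m2 by (intro lborel.borel_measurable_nn_integral) (simp add: case_prod_unfold)
  have "(\<integral>\<^sup>+u. f u \<partial>PiM (insert i N) (\<lambda>_. lborel)) = (\<integral>\<^sup>+x. \<integral>\<^sup>+y. f (x(i := y)) \<partial>lborel \<partial>?P)"
    using insert.hyps by (subst lborel_product.product_nn_integral_insert) auto
  also have "\<dots> = ennreal (c ^ card N) * (\<integral>\<^sup>+x. \<integral>\<^sup>+y. f ((scale_fun N c x)(i := y)) \<partial>lborel \<partial>?P)"
    by (rule insert.IH[OF m3])
  also have "(\<integral>\<^sup>+x. \<integral>\<^sup>+y. f ((scale_fun N c x)(i := y)) \<partial>lborel \<partial>?P)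
     = (\<integral>\<^sup>+x. ennreal c * (\<integral>\<^sup>+y. f (scale_fun (insert i N) c (x(i := y))) \<partial>lborel) \<partial>?P)"
  proof (rule nn_integral_cong)
    fix x assume x: "x \<in> space ?P"
    have gx: "scale_fun N c x \<in> space ?P" using scale_fun_measurable x by (rule measurable_space)
    have [measurable]: "(\<lambda>y. f ((scale_fun N c x)(i := y))) \<in> borel_measurable borel"
      using measurable_Pair2[OF m2 gx] by simp
    show "(\<integral>\<^sup>+y. f ((scale_fun N c x)(i := y)) \<partial>lborel)
      = ennreal c * (\<integral>\<^sup>+y. f (scale_fun (insert i N) c (x(i := y))) \<partial>lborel)"
      unfolding upd using assms(2)
      by (subst nn_integral_real_affine[of _ c 0]) auto
  qed
  also have "\<dots> = ennreal c * (\<integral>\<^sup>+x. \<integral>\<^sup>+y. f (scale_fun (insert i N) c (x(i := y))) \<partial>lborel \<partial>?P)"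
  proof (rule nn_integral_cmult)
    have "(\<lambda>p. f (scale_fun (insert i N) c ((fst p)(i := snd p)))) \<in> borel_measurable (?P \<Otimes>\<^sub>M lborel)"
      by measurable
    thus "(\<lambda>x. \<integral>\<^sup>+y. f (scale_fun (insert i N) c (x(i := y))) \<partial>lborel) \<in> borel_measurable ?P"
      by (intro lborel.borel_measurable_nn_integral) (simp add: case_prod_unfold)
  qed
  also have "(\<integral>\<^sup>+x. \<integral>\<^sup>+y. f (scale_fun (insert i N) c (x(i := y))) \<partial>lborel \<partial>?P)
    = (\<integral>\<^sup>+u. f (scale_fun (insert i N) c u) \<partial>PiM (insert i N) (\<lambda>_. lborel))"
    using insert.hyps by (subst lborel_product.product_nn_integral_insert) auto
  finally show ?case
    using insert.hyps assms(2) by (simp add: ennreal_mult mult_ac)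
qed

text \<open>Scaling as an equality of measures, so that it transfers to Bochner integrals without an
  integrability assumption.\<close>

lemma density_distr_scale_fun:
  assumes "finite N" "c > 0"
  shows "density (distr (PiM N (\<lambda>_. lborel)) (PiM N (\<lambda>_. lborel)) (scale_fun N c)) (\<lambda>_. ennreal (c ^ card N))
    = PiM N (\<lambda>_. lborel)" (is "?D = ?P")
proof (rule measure_eqI)
  fix B assume B: "B \<in> sets ?D"
  hence [measurable]: "B \<in> sets ?P" by simp
  have "emeasure ?P B = ennreal (c ^ card N) * (\<integral>\<^sup>+u. indicator B (scale_fun N c u) \<partial>?P)"
    using nn_integral_scale_fun[OF assms, of "indicator B"] by simp
  also have "(\<integral>\<^sup>+u. indicator B (scale_fun N c u) \<partial>?P) = emeasure (distr ?P ?P (scale_fun N c)) B"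
    using nn_integral_distr[of "scale_fun N c" ?P ?P "indicator B"] by simp
  finally show "emeasure ?D B = emeasure ?P B"
    by (simp add: emeasure_density nn_integral_cmult)
qed simp

lemma integral_scale_fun:
  fixes f :: "('i \<Rightarrow> real) \<Rightarrow> complex"
  assumes "finite N" "c > 0" and [measurable]: "f \<in> borel_measurable (PiM N (\<lambda>_. lborel))"
  shows "(\<integral>u. f u \<partial>PiM N (\<lambda>_. lborel))
    = of_real (c ^ card N) * (\<integral>u. f (scale_fun N c u) \<partial>PiM N (\<lambda>_. lborel))"
proof -
  have "(\<integral>u. f u \<partial>PiM N (\<lambda>_. lborel))
    = (\<integral>u. f u \<partial>density (distr (PiM N (\<lambda>_. lborel)) (PiM N (\<lambda>_. lborel)) (scale_fun N c)) (\<lambda>_. ennreal (c ^ card N)))"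
    by (subst density_distr_scale_fun[OF assms(1,2)]) simp
  also have "\<dots> = (\<integral>u. c ^ card N *\<^sub>R f (scale_fun N c u) \<partial>PiM N (\<lambda>_. lborel))"
    using assms(2) by (subst integral_density) (auto simp: integral_distr)
  finally show ?thesis by (simp add: scaleR_conv_of_real)
qed

section \<open>Integrals of products of linear forms\<close>

text \<open>Majorant in one coordinate: the power governs \<open>y\<close> near 0, the summand 1
  governs large \<open>y\<close>, and \<open>exp (- y / 2)\<close> is the half of the weight that
  remains after the other half has been spent on polynomial growth.\<close>

definition decay :: "real \<Rightarrow> real \<Rightarrow> real" where
  "decay \<delta> y = (if 0 < y then (y powr (\<delta> - 1) + 1) * exp (- y / 2) else 0)"

lemma decay_nonneg: "decay \<delta> y \<ge> 0"
  by (auto simp: decay_def)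

lemma integrable_decay:
  assumes "\<delta> > 0"
  shows "integrable lborel (decay \<delta>)"
proof -
  have *: "integrable lborel (\<lambda>y. indicator {0<..} y * (y powr (a - 1) * exp (- y / 2)))" if "a > 0" for a :: real
  proof -
    let ?f = "\<lambda>t. complex_of_real t powr (complex_of_real a - 1) / of_real (exp (1/2 * t))"
    have "integrable lebesgue (\<lambda>t. indicator {0<..} t *\<^sub>R ?f t)"
      using absolutely_integrable_Gamma_integral[of "complex_of_real a" "1/2"] that
      by (simp add: set_integrable_def)
    hence "integrable lebesgue (\<lambda>t. norm (indicator {0<..} t *\<^sub>R ?f t))"
      by (rule integrable_norm)
    also have "(\<lambda>t. norm (indicator {0<..} t *\<^sub>R ?f t))
       = (\<lambda>y. indicator {0<..} y * (y powr (a - 1) * exp (- y / 2)))"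
    proof
      fix t :: real
      show "norm (indicator {0<..} t *\<^sub>R ?f t) = indicator {0<..} t * (t powr (a - 1) * exp (- t / 2))"
      proof (cases "t > 0")
        case True
        hence "norm (?f t) = t powr (a - 1) / exp (t / 2)"
          by (simp add: norm_divide norm_powr_real_powr)
        with True show ?thesis by (simp add: exp_minus inverse_eq_divide)
      qed auto
    qed
    finally show ?thesis
      using integrable_completion[of "\<lambda>y. indicator {0<..} y * (y powr (a - 1) * exp (- y / 2))" lborel]
      by simp
  qed
  have "decay \<delta> = (\<lambda>y. indicator {0<..} y * (y powr (\<delta> - 1) * exp (- y / 2))
      + indicator {0<..} y * (y powr (1 - 1) * exp (- y / 2)))"
    by (auto simp: decay_def fun_eq_iff indicator_def algebra_simps)
  thus ?thesis using *[OF assms] *[of 1] by simp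
qed

text \<open>Serves to kill the boundary terms of the integration by parts, which are bounded by a
  multiple of \<open>y * decay \<delta> y\<close>.\<close>

lemma tendsto_times_decay:
  assumes "\<delta> > 0"
  shows "((\<lambda>y. y * decay \<delta> y) \<longlongrightarrow> 0) (at_right 0)" "((\<lambda>y. y * decay \<delta> y) \<longlongrightarrow> 0) at_top"
proof -
  have eq: "y * decay \<delta> y = (y powr \<delta> + y) * exp (- y / 2)" if "y > 0" for y
    using that powr_add[of y "\<delta> - 1" 1] by (simp add: decay_def algebra_simps)
  have "((\<lambda>y. (y powr \<delta> + y) * exp (- y / 2)) \<longlongrightarrow> (0 + 0) * exp (- 0 / 2)) (at_right 0)"
    using assms by (intro tendsto_intros tendsto_zero_powrI[where b = \<delta>])
      (auto simp: eventually_at_right_less intro!: eventually_mono[OF eventually_at_right_less[of 0]])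
  moreover have "eventually (\<lambda>y. (y powr \<delta> + y) * exp (- y / 2) = y * decay \<delta> y) (at_right 0)"
    using eq by (auto intro!: eventually_mono[OF eventually_at_right_less[of 0]])
  ultimately show "((\<lambda>y. y * decay \<delta> y) \<longlongrightarrow> 0) (at_right 0)"
    using Lim_transform_eventually by force
  obtain n :: nat where n: "\<delta> \<le> n" using real_arch_simple by blast
  have lim: "((\<lambda>y::real. y ^ m * exp (- y / 2)) \<longlongrightarrow> 0) at_top" for m :: nat
  proof -
    have "((\<lambda>y::real. 2 ^ m * ((y / 2) ^ m / exp (y / 2))) \<longlongrightarrow> 2 ^ m * 0) at_top"
      by (intro tendsto_mult tendsto_const filterlim_compose[OF tendsto_power_div_exp_0])
        (use filterlim_tendsto_pos_mult_at_top[OF tendsto_const[of "1 / 2 :: real"] _ filterlim_ident] in simp)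
    thus ?thesis by (simp add: exp_minus power_divide inverse_eq_divide)
  qed
  have "((\<lambda>y::real. y ^ n * exp (- y / 2) + y ^ 1 * exp (- y / 2)) \<longlongrightarrow> 0 + 0) at_top"
    by (intro tendsto_add lim)
  moreover have "eventually (\<lambda>y. norm (y * decay \<delta> y) \<le> y ^ n * exp (- y / 2) + y ^ 1 * exp (- y / 2)) at_top"
    using eventually_ge_at_top[of 1]
  proof eventually_elim
    case (elim y)
    hence "y powr \<delta> \<le> y powr n" using n by (intro powr_mono) auto
    hence "y powr \<delta> \<le> y ^ n" using elim by (simp add: powr_realpow)
    thus ?case using elim eq[of y] by (simp add: algebra_simps mult_right_mono)
  qed
  ultimately show "((\<lambda>y. y * decay \<delta> y) \<longlongrightarrow> 0) at_top"
    using Lim_null_comparison[of "\<lambda>y. y * decay \<delta> y"] by simp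
qed

section \<open>Absolute convergence of the weighted integrals\<close>

locale linear_forms =
  fixes N :: "'i set" and K :: "'j set" and A :: "'j \<Rightarrow> 'i set"
  assumes finite_N [simp, intro]: "finite N" and finite_K [simp, intro]: "finite K"
    and A_sub: "\<And>j. j \<in> K \<Longrightarrow> A j \<subseteq> N" and A_ne: "\<And>j. j \<in> K \<Longrightarrow> A j \<noteq> {}"
    and few_forms: "\<And>S. S \<subseteq> N \<Longrightarrow> card {j \<in> K. A j \<subseteq> S} \<le> card S"
begin

abbreviation "MN \<equiv> PiM N (\<lambda>_. lborel :: real measure)"

definition form :: "'j \<Rightarrow> ('i \<Rightarrow> real) \<Rightarrow> real" where "form j u = (\<Sum>i\<in>A j. u i)"

definition pos :: "('i \<Rightarrow> real) \<Rightarrow> bool" where "pos u \<longleftrightarrow> (\<forall>i\<in>N. 0 < u i)"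

text \<open>Logarithms let the complex exponent enter as \<open>exp (s * g)\<close> with a real
  function \<open>g\<close>, the shape required by \<open>holomorphic_exp_integral\<close>, and turn
  differentiation of the products into differentiation of sums.\<close>

definition log_forms :: "('i \<Rightarrow> real) \<Rightarrow> real" where "log_forms u = (\<Sum>j\<in>K. ln (form j u))"

definition log_weight :: "('i \<Rightarrow> nat) \<Rightarrow> ('j \<Rightarrow> nat) \<Rightarrow> ('i \<Rightarrow> real) \<Rightarrow> real" where
  "log_weight p q u = (\<Sum>i\<in>N. p i * ln (u i)) - (\<Sum>j\<in>K. q j * ln (form j u)) - (\<Sum>i\<in>N. u i)"

definition weight :: "('i \<Rightarrow> nat) \<Rightarrow> ('j \<Rightarrow> nat) \<Rightarrow> ('i \<Rightarrow> real) \<Rightarrow> complex" where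
  "weight p q u = (if pos u then of_real (exp (log_weight p q u)) else 0)"

definition E :: "('i \<Rightarrow> nat) \<Rightarrow> ('j \<Rightarrow> nat) \<Rightarrow> complex \<Rightarrow> ('i \<Rightarrow> real) \<Rightarrow> complex" where
  "E p q s u = weight p q u * exp (s * of_real (log_forms u))"

definition J :: "('i \<Rightarrow> nat) \<Rightarrow> ('j \<Rightarrow> nat) \<Rightarrow> complex \<Rightarrow> complex" where
  "J p q s = (\<integral>u. E p q s u \<partial>MN)"

definition num_inside :: "'i set \<Rightarrow> nat" where "num_inside S = card {j \<in> K. A j \<subseteq> S}"

text \<open>If the coordinates in \<open>S\<close> are of size \<open>t\<close> and \<open>Re s = \<sigma>\<close>, then \<open>E p q s\<close> times the volume element
  has size \<open>t\<close> to the power given by the difference of the two sums.\<close>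

definition converges :: "('i \<Rightarrow> nat) \<Rightarrow> ('j \<Rightarrow> nat) \<Rightarrow> real \<Rightarrow> bool" where
  "converges p q \<sigma> \<longleftrightarrow> (\<forall>S\<subseteq>N. S \<noteq> {} \<longrightarrow>
     (\<Sum>j | j \<in> K \<and> A j \<subseteq> S. real (q j) - \<sigma>) < (\<Sum>i\<in>S. real (p i) + 1))"

lemma form_pos: "pos u \<Longrightarrow> j \<in> K \<Longrightarrow> form j u > 0"
  unfolding form_def pos_def using A_sub A_ne finite_subset[OF A_sub finite_N]
  by (intro sum_pos) auto

lemma component_le_form: "pos u \<Longrightarrow> j \<in> K \<Longrightarrow> i \<in> A j \<Longrightarrow> u i \<le> form j u"
  unfolding form_def pos_def using A_sub finite_subset[OF A_sub finite_N]
  by (intro member_le_sum) (auto intro: less_imp_le)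

lemma form_le_sum: "pos u \<Longrightarrow> j \<in> K \<Longrightarrow> form j u \<le> (\<Sum>i\<in>N. u i)"
  unfolding form_def pos_def using A_sub by (intro sum_mono2) (auto intro: less_imp_le)

lemma form_measurable [measurable]: "j \<in> K \<Longrightarrow> form j \<in> borel_measurable MN"
  unfolding form_def using A_sub by (intro borel_measurable_sum) (measurable, auto)

lemma pos_measurable [measurable]: "Measurable.pred MN pos"
  unfolding pos_def by measurable

lemma log_forms_measurable [measurable]: "log_forms \<in> borel_measurable MN"
  unfolding log_forms_def by measurable

lemma log_weight_measurable [measurable]: "log_weight p q \<in> borel_measurable MN"
  unfolding log_weight_def by measurable

lemma weight_measurable [measurable]: "weight p q \<in> borel_measurable MN"
  unfolding weight_def by measurable

lemma E_measurable [measurable]: "E p q s \<in> borel_measurable MN"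
  unfolding E_def by measurable

lemma norm_E: "pos u \<Longrightarrow> norm (E p q s u) = exp (log_weight p q u + Re s * log_forms u)"
  by (simp add: E_def weight_def norm_mult exp_add)

text \<open>The tangent bound \<open>ln x \<le> x - 1\<close> at
  \<open>x = (1 + T) / (2 * R)\<close>: any power of \<open>1 + T\<close> costs only half of the
  exponential weight \<open>exp (- T)\<close>, up to a constant.\<close>

lemma mult_ln_le_half: "R * ln (1 + T) \<le> (1 + T) / 2 + R * ln (2 * R)" if "R > 0" "T \<ge> 0" for R T :: real
proof -
  have "ln ((1 + T) / (2 * R)) \<le> (1 + T) / (2 * R) - 1"
    using that by (intro ln_le_minus_one) auto
  hence "ln (1 + T) \<le> (1 + T) / (2 * R) + ln (2 * R)"
    using that by (simp add: ln_div)
  hence "R * ln (1 + T) \<le> R * ((1 + T) / (2 * R) + ln (2 * R))"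
    using that by (intro mult_left_mono) auto
  also have "\<dots> = (1 + T) / 2 + R * ln (2 * R)"
    using that(1) by (simp add: distrib_left add_divide_distrib)
  finally show ?thesis .
qed

text \<open>After taking logarithms, \<open>sum_weights_le_sum_max\<close> converts the conditions
  on all sets \<open>S\<close> into a bound by a product of functions of one coordinate each. Only
  the negative parts \<open>y\<close> and \<open>m\<close> of the logarithms enter there; the
  positive parts are at most \<open>ln (1 + T)\<close> and are absorbed by the weight.\<close>

lemma norm_E_le:
  assumes cv: "converges p q \<sigma>" and \<sigma>: "\<sigma> \<le> 0" and s: "\<sigma> \<le> Re s"
  obtains C \<delta> where "C \<ge> 0" "\<delta> > 0" "\<And>u. norm (E p q s u) \<le> C * (\<Prod>i\<in>N. decay \<delta> (u i))"
proof -
  define gap where "gap = (\<lambda>S. (\<Sum>i\<in>S. real (p i) + 1) - (\<Sum>j | j \<in> K \<and> A j \<subseteq> S. real (q j) - \<sigma>))"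
  \<comment> \<open>The smallest slack per coordinate over all nonempty sets, so that lowering each
    exponent \<open>p i + 1\<close> by \<open>\<delta>\<close> preserves the inequalities. The entry
    \<open>1/2\<close> covers an empty \<open>N\<close>.\<close>
  define \<delta> where "\<delta> = Min (insert (1/2) ((\<lambda>S. gap S / card S) ` (Pow N - {{}})))"
  have \<delta>le: "\<delta> \<le> gap S / card S" if "S \<subseteq> N" "S \<noteq> {}" for S
    unfolding \<delta>_def using that by (intro Min_le) auto
  have "\<delta> \<in> insert (1/2) ((\<lambda>S. gap S / card S) ` (Pow N - {{}}))"
    unfolding \<delta>_def by (intro Min_in) auto
  moreover have "gap S / card S > 0" if "S \<subseteq> N" "S \<noteq> {}" for S
    using cv that finite_subset[OF that(1) finite_N]
    by (auto simp: gap_def converges_def card_gt_0_iff intro!: divide_pos_pos)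
  ultimately have \<delta>: "\<delta> > 0" by auto
  have \<delta>1: "\<delta> \<le> 1/2" unfolding \<delta>_def by (intro Min_le) auto
  \<comment> \<open>Counts the factors \<open>1 + T\<close> lost in the estimates:
    \<open>p i\<close> for each coordinate and \<open>\<bar>Re s\<bar>\<close> for each form. The
    extra 1 makes \<open>R\<close> positive.\<close>
  define R where "R = (\<Sum>i\<in>N. real (p i)) + card K * \<bar>Re s\<bar> + 1"
  have R: "R > 0" unfolding R_def by (intro add_nonneg_pos) (auto intro!: sum_nonneg add_nonneg_nonneg)
  define C where "C = exp (1 / 2 + R * ln (2 * R))"
  have "norm (E p q s u) \<le> C * (\<Prod>i\<in>N. decay \<delta> (u i))" for u
  proof (cases "pos u")
    case False
    thus ?thesis by (simp add: E_def weight_def C_def decay_nonneg prod_nonneg)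
  next
    case True
    define T where "T = (\<Sum>i\<in>N. u i)"
    have T: "T \<ge> 0" unfolding T_def using True by (intro sum_nonneg) (auto simp: pos_def intro: less_imp_le)
    define y where "y = (\<lambda>i. min 0 (ln (u i)))"
    define m where "m = (\<lambda>j. min 0 (ln (form j u)))"
    have ui: "u i > 0" if "i \<in> N" for i using True that by (auto simp: pos_def)
    have main: "(\<Sum>i\<in>N. (real (p i) + 1 - \<delta>) * y i) \<le> (\<Sum>j\<in>K. (real (q j) - \<sigma>) * m j)"
    proof (rule sum_weights_le_sum_max[OF finite_N finite_K A_sub A_ne])
      fix S assume S: "S \<subseteq> N" "S \<noteq> {}"
      hence "card S > 0" using finite_subset[OF S(1) finite_N] by (simp add: card_gt_0_iff)
      hence "\<delta> * card S \<le> gap S" using \<delta>le[OF S] by (simp add: field_simps)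
      thus "(\<Sum>j | j \<in> K \<and> A j \<subseteq> S. real (q j) - \<sigma>) \<le> (\<Sum>i\<in>S. real (p i) + 1 - \<delta>)"
        by (simp add: gap_def sum.distrib sum_subtractf mult.commute)
    next
      fix i j assume ij: "j \<in> K" "i \<in> A j"
      hence "i \<in> N" using A_sub by auto
      thus "y i \<le> m j" using component_le_form[OF True ij] ui form_pos[OF True ij(1)]
        by (auto simp: y_def m_def min_def)
    qed (use \<sigma> in \<open>auto simp: y_def\<close>)
    have 1: "(\<Sum>i\<in>N. p i * ln (u i)) \<le> (\<Sum>i\<in>N. p i * y i + p i * ln (1 + T))"
    proof (rule sum_mono)
      fix i assume i: "i \<in> N"
      have "u i \<le> T" unfolding T_def using i ui by (intro member_le_sum) (auto intro: less_imp_le)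
      hence "ln (u i) \<le> ln (1 + T)" using ui[OF i] by (subst ln_le_cancel_iff) auto
      moreover have "0 \<le> ln (1 + T)" using T by simp
      ultimately have "ln (u i) \<le> y i + ln (1 + T)" by (auto simp: y_def min_def)
      hence "p i * ln (u i) \<le> p i * (y i + ln (1 + T))" by (intro mult_left_mono) auto
      thus "p i * ln (u i) \<le> p i * y i + p i * ln (1 + T)" by (simp add: algebra_simps)
    qed
    have 2: "(\<Sum>j\<in>K. (Re s - q j) * ln (form j u)) \<le> (\<Sum>j\<in>K. - ((q j - \<sigma>) * m j) + \<bar>Re s\<bar> * ln (1 + T))"
    proof (rule sum_mono)
      fix j assume j: "j \<in> K"
      have fp: "form j u > 0" by (rule form_pos[OF True j])
      have "form j u \<le> T" unfolding T_def by (rule form_le_sum[OF True j])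
      hence lnle: "ln (form j u) \<le> ln (1 + T)" using fp by (subst ln_le_cancel_iff) auto
      have ln0: "0 \<le> ln (1 + T)" using T by simp
      show "(Re s - q j) * ln (form j u) \<le> - ((q j - \<sigma>) * m j) + \<bar>Re s\<bar> * ln (1 + T)"
      \<comment> \<open>For a form below 1 the smaller exponent \<open>\<sigma> - q j\<close> gives
        the larger power. For a form above 1 the division by its \<open>q j\<close>-th power only
        helps.\<close>
      proof (cases "ln (form j u) \<le> 0")
        case True
        hence "(Re s - q j) * ln (form j u) \<le> (\<sigma> - q j) * ln (form j u)"
          using s by (intro mult_right_mono_neg) auto
        moreover have "0 \<le> \<bar>Re s\<bar> * ln (1 + T)" using ln0 by simp
        ultimately show ?thesis using True by (simp add: m_def min_def algebra_simps)
      next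
        case False
        hence "(Re s - q j) * ln (form j u) \<le> \<bar>Re s\<bar> * ln (1 + T)"
          using lnle by (intro mult_mono) auto
        thus ?thesis using False by (simp add: m_def)
      qed
    qed
    have "log_weight p q u + Re s * log_forms u
       = (\<Sum>i\<in>N. p i * ln (u i)) + (\<Sum>j\<in>K. (Re s - q j) * ln (form j u)) - T"
      by (simp add: log_weight_def log_forms_def T_def sum_distrib_left sum_subtractf left_diff_distrib)
    also have "\<dots> \<le> (\<Sum>i\<in>N. p i * y i + p i * ln (1 + T))
        + (\<Sum>j\<in>K. - ((q j - \<sigma>) * m j) + \<bar>Re s\<bar> * ln (1 + T)) - T"
      using 1 2 by simp
    also have "\<dots> = (\<Sum>i\<in>N. p i * y i) - (\<Sum>j\<in>K. (q j - \<sigma>) * m j) + (R - 1) * ln (1 + T) - T"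
      by (simp add: R_def sum.distrib sum_negf sum_distrib_left sum_subtractf algebra_simps)
    also have "\<dots> \<le> (\<Sum>i\<in>N. p i * y i) - (\<Sum>i\<in>N. (real (p i) + 1 - \<delta>) * y i) + R * ln (1 + T) - T"
    proof -
      have "(R - 1) * ln (1 + T) \<le> R * ln (1 + T)" using T by (intro mult_right_mono) auto
      thus ?thesis using main by linarith
    qed
    also have "\<dots> = (\<Sum>i\<in>N. (\<delta> - 1) * y i) + R * ln (1 + T) - T"
      by (simp add: algebra_simps sum.distrib sum_subtractf)
    also have "\<dots> \<le> (\<Sum>i\<in>N. (\<delta> - 1) * y i) + (1 / 2 + R * ln (2 * R)) - T / 2"
      using mult_ln_le_half[OF R T] by (simp add: field_simps)
    also have "\<dots> = (1 / 2 + R * ln (2 * R)) + (\<Sum>i\<in>N. (\<delta> - 1) * y i + (- u i / 2))"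
      by (simp add: T_def sum.distrib sum_negf sum_subtractf sum_divide_distrib)
    finally have "norm (E p q s u) \<le> exp ((1 / 2 + R * ln (2 * R)) + (\<Sum>i\<in>N. (\<delta> - 1) * y i + (- u i / 2)))"
      using norm_E[OF True] by simp
    also have "\<dots> = C * (\<Prod>i\<in>N. exp ((\<delta> - 1) * y i) * exp (- u i / 2))"
      by (simp only: exp_add exp_sum[OF finite_N] C_def)
    also have "\<dots> \<le> C * (\<Prod>i\<in>N. decay \<delta> (u i))"
    proof (intro mult_left_mono prod_mono conjI)
      fix i assume i: "i \<in> N"
      have "exp ((\<delta> - 1) * y i) \<le> u i powr (\<delta> - 1) + 1"
        using ui[OF i] by (auto simp: y_def min_def powr_def)
      thus "exp ((\<delta> - 1) * y i) * exp (- u i / 2) \<le> decay \<delta> (u i)"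
        using ui[OF i] by (auto simp: decay_def intro!: mult_right_mono)
    qed (auto simp: C_def)
    finally show ?thesis .
  qed
  with \<delta> show ?thesis by (intro that[of C \<delta>]) (auto simp: C_def)
qed

lemma integrable_E:
  assumes "converges p q \<sigma>" "\<sigma> \<le> 0" "\<sigma> \<le> Re s"
  shows "integrable MN (E p q s)"
proof -
  obtain C \<delta> where C: "C \<ge> 0" "\<delta> > 0" "\<And>u. norm (E p q s u) \<le> C * (\<Prod>i\<in>N. decay \<delta> (u i))"
    using norm_E_le[OF assms] by blast
  have "integrable MN (\<lambda>u. C * (\<Prod>i\<in>N. decay \<delta> (u i)))"
    using C(2) by (intro integrable_mult_right lborel_product.product_integrable_prod integrable_decay) auto
  thus ?thesis
  proof (rule Bochner_Integration.integrable_bound)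
    show "AE u in MN. norm (E p q s u) \<le> norm (C * (\<Prod>i\<in>N. decay \<delta> (u i)))"
      using C(3) by (intro AE_I2) (metis abs_ge_self order_trans real_norm_def)
  qed simp
qed

lemma J_holomorphic:
  assumes cv: "converges p q \<sigma>" and \<sigma>: "\<sigma> \<le> 0"
  shows "J p q holomorphic_on {s. \<sigma> < Re s}"
proof -
  have "(\<lambda>s. \<integral>u. weight p q u * exp (s * of_real (log_forms u)) \<partial>MN) holomorphic_on {s. \<sigma> < Re s}"
  proof (rule holomorphic_exp_integral)
    fix r :: real assume "\<sigma> < r"
    thus "integrable MN (\<lambda>u. weight p q u * exp (of_real r * of_real (log_forms u)))"
      using integrable_E[OF cv \<sigma>, of "of_real r"] by (simp add: E_def[abs_def])
  qed auto
  thus ?thesis by (simp add: J_def[abs_def] E_def[abs_def])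
qed

section \<open>Integration by parts with shifted exponents\<close>

abbreviation inc :: "('a \<Rightarrow> nat) \<Rightarrow> 'a \<Rightarrow> 'a \<Rightarrow> nat" where "inc p i \<equiv> p(i := Suc (p i))"

lemma E_inc_left:
  assumes "i \<in> N"
  shows "E (inc p i) q s u = of_real (u i) * E p q s u"
proof (cases "pos u")
  case True
  have "(\<Sum>i'\<in>N. real (inc p i i') * ln (u i')) = (\<Sum>i'\<in>N. p i' * ln (u i')) + ln (u i)"
    using assms by (subst (1 2) sum.remove[of N i]) (auto simp: algebra_simps)
  hence "log_weight (inc p i) q u = log_weight p q u + ln (u i)"
    by (simp add: log_weight_def)
  with True assms show ?thesis by (simp add: E_def weight_def exp_add pos_def)
qed (simp add: E_def weight_def)

lemma E_inc_right:
  assumes "j \<in> K"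
  shows "E p (inc q j) s u = E p q s u / of_real (form j u)"
proof (cases "pos u")
  case True
  have "(\<Sum>j'\<in>K. real (inc q j j') * ln (form j' u)) = (\<Sum>j'\<in>K. q j' * ln (form j' u)) + ln (form j u)"
    using assms by (subst (1 2) sum.remove[of K j]) (auto simp: algebra_simps)
  hence "log_weight p (inc q j) u = log_weight p q u - ln (form j u)"
    by (simp add: log_weight_def)
  with True assms form_pos[OF True assms] show ?thesis
    by (simp add: E_def weight_def exp_diff)
qed (simp add: E_def weight_def)

text \<open>Raising \<open>p i\<close> and \<open>q j\<close> together multiplies the integrand by
  \<open>u i / form j\<close>, and these quotients add up to 1 over \<open>A j\<close>. This turns
  the contributions of forms inside \<open>S\<close> back into multiples of the original
  integral.\<close>

lemma sum_E_inc:
  assumes "j \<in> K"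
  shows "(\<Sum>i\<in>A j. E (inc p i) (inc q j) s u) = E p q s u"
proof (cases "pos u")
  case True
  have "(\<Sum>i\<in>A j. E (inc p i) (inc q j) s u) = (\<Sum>i\<in>A j. of_real (u i) * (E p q s u / of_real (form j u)))"
    using A_sub[OF assms] by (intro sum.cong) (auto simp: E_inc_left E_inc_right[OF assms])
  also have "\<dots> = of_real (form j u) * (E p q s u / of_real (form j u))"
    unfolding form_def of_real_sum by (rule sum_distrib_right[symmetric])
  finally show ?thesis using form_pos[OF True assms] by simp
qed (simp add: E_def weight_def)

lemma E_has_vector_derivative:
  assumes i: "i \<in> N" and x: "\<And>i'. i' \<in> N - {i} \<Longrightarrow> x i' > 0" and y: "y > 0"
  shows "((\<lambda>y. E p q s (x(i := y))) has_vector_derivative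
    E p q s (x(i := y)) * (of_real (p i / y - 1) + (\<Sum>j | j \<in> K \<and> i \<in> A j. (s - of_nat (q j)) / of_real (form j (x(i := y))))))
    (at y)"
proof -
  have posy: "pos (x(i := y))" if "y > 0" for y using x that by (auto simp: pos_def)
  have comp: "((\<lambda>y. (x(i := y)) i') has_real_derivative (if i' = i then 1 else 0)) (at y)" for i'
    by (cases "i' = i") auto
  have form: "((\<lambda>y. form j (x(i := y))) has_real_derivative (if i \<in> A j then 1 else 0)) (at y)" if "j \<in> K" for j
  proof -
    have "((\<lambda>y. form j (x(i := y))) has_real_derivative (\<Sum>i'\<in>A j. if i' = i then 1 else 0)) (at y)"
      unfolding form_def by (intro DERIV_sum comp)
    thus ?thesis using finite_subset[OF A_sub[OF that] finite_N] by simp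
  qed
  let ?f = "\<lambda>j. form j (x(i := y))"
  have fp: "?f j > 0" if "j \<in> K" for j using form_pos[OF posy[OF y] that] .
  have lnform: "((\<lambda>y. ln (form j (x(i := y)))) has_real_derivative (if i \<in> A j then 1 / ?f j else 0)) (at y)"
    if "j \<in> K" for j
    using DERIV_chain2[OF DERIV_ln_divide[OF fp[OF that]] form[OF that]] by (rule DERIV_cong) auto
  have lf: "((\<lambda>y. log_forms (x(i := y))) has_real_derivative (\<Sum>j\<in>K. if i \<in> A j then 1 / ?f j else 0)) (at y)"
    unfolding log_forms_def by (intro DERIV_sum lnform)
  have lncomp: "((\<lambda>y. ln ((x(i := y)) i')) has_real_derivative (if i' = i then 1 / y else 0)) (at y)" for i'
    using y by (cases "i' = i") (auto intro!: derivative_eq_intros)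
  have lw: "((\<lambda>y. log_weight p q (x(i := y))) has_real_derivative
      ((\<Sum>i'\<in>N. p i' * (if i' = i then 1 / y else 0)) - (\<Sum>j\<in>K. q j * (if i \<in> A j then 1 / ?f j else 0))
        - (\<Sum>i'\<in>N. if i' = i then 1 else 0))) (at y)"
    unfolding log_weight_def by (intro DERIV_diff DERIV_sum DERIV_cmult lncomp lnform comp)
  let ?D = "of_real ((\<Sum>i'\<in>N. p i' * (if i' = i then 1 / y else 0)) - (\<Sum>j\<in>K. q j * (if i \<in> A j then 1 / ?f j else 0))
        - (\<Sum>i'\<in>N. if i' = i then 1 else 0)) + s * of_real (\<Sum>j\<in>K. if i \<in> A j then 1 / ?f j else 0)"
  have "((\<lambda>y. of_real (log_weight p q (x(i := y))) + s * of_real (log_forms (x(i := y)))) has_vector_derivative ?D) (at y)"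
    by (intro has_vector_derivative_add has_vector_derivative_of_real lw
         bounded_linear.has_vector_derivative[OF bounded_linear_mult_right] lf)
  from field_vector_diff_chain_at[OF this DERIV_exp]
  have D: "((\<lambda>y. exp (of_real (log_weight p q (x(i := y))) + s * of_real (log_forms (x(i := y)))))
     has_vector_derivative ?D * exp (of_real (log_weight p q (x(i := y))) + s * of_real (log_forms (x(i := y))))) (at y)"
    by (simp only: o_def)
  have E: "exp (of_real (log_weight p q (x(i := y))) + s * of_real (log_forms (x(i := y)))) = E p q s (x(i := y))"
    if "y > 0" for y
    using posy[OF that] by (simp add: E_def weight_def exp_add exp_of_real)
  \<comment> \<open>\<open>E\<close> is cut off by \<open>pos\<close>, so it agrees with the
    exponential only on the open half line, which is enough for a derivative at a point
    \<open>y > 0\<close>.\<close>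
  have "((\<lambda>y. E p q s (x(i := y))) has_vector_derivative ?D * E p q s (x(i := y))) (at y)"
    unfolding E[OF y, symmetric]
    by (rule has_vector_derivative_transform_within_open[OF D open_greaterThan[of 0]]) (use y E in auto)
  moreover have "?D = of_real (p i / y - 1) + (\<Sum>j | j \<in> K \<and> i \<in> A j. (s - of_nat (q j)) / of_real (?f j))"
  proof -
    have 1: "(\<Sum>i'\<in>N. p i' * (if i' = i then 1 / y else 0)) = p i / y" "(\<Sum>i'\<in>N. if i' = i then 1 else 0 :: real) = 1"
      using i by (simp_all add: if_distrib[of "\<lambda>z. _ * z"] cong: if_cong)
    have 2: "(\<Sum>j | j \<in> K \<and> i \<in> A j. (s - of_nat (q j)) / of_real (?f j))
      = (\<Sum>j\<in>K. (s - of_nat (q j)) * of_real (if i \<in> A j then 1 / ?f j else 0))"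
      by (rule sum.mono_neutral_cong_left) auto
    show ?thesis unfolding 1 2
      by (simp add: sum_distrib_left sum_subtractf left_diff_distrib)
  qed
  ultimately show ?thesis by (simp add: mult.commute)
qed

text \<open>The derivative of \<open>u i * E p q s u\<close> with respect to \<open>u i\<close>. The
  factors \<open>u i\<close> and \<open>u i / form j\<close> that it produces are written as shifts
  of the exponents, so that everything stays within the family \<open>E\<close>.\<close>

definition ibp :: "('i \<Rightarrow> nat) \<Rightarrow> ('j \<Rightarrow> nat) \<Rightarrow> complex \<Rightarrow> 'i \<Rightarrow> ('i \<Rightarrow> real) \<Rightarrow> complex" where
  "ibp p q s i u = of_nat (Suc (p i)) * E p q s u
     + (\<Sum>j | j \<in> K \<and> i \<in> A j. (s - of_nat (q j)) * E (inc p i) (inc q j) s u) - E (inc p i) q s u"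

lemma ibp_has_vector_derivative:
  assumes i: "i \<in> N" and x: "\<And>i'. i' \<in> N - {i} \<Longrightarrow> x i' > 0" and y: "y > 0"
  shows "((\<lambda>y. of_real y * E p q s (x(i := y))) has_vector_derivative ibp p q s i (x(i := y))) (at y)"
proof -
  let ?e = "E p q s (x(i := y))"
  let ?S = "\<Sum>j | j \<in> K \<and> i \<in> A j. (s - of_nat (q j)) / of_real (form j (x(i := y)))"
  have "((\<lambda>y. of_real y * E p q s (x(i := y))) has_vector_derivative
     of_real y * (?e * (of_real (p i / y - 1) + ?S)) + of_real 1 * ?e) (at y)"
    by (intro has_vector_derivative_mult E_has_vector_derivative assms has_vector_derivative_of_real DERIV_ident)
  moreover have "(\<Sum>j | j \<in> K \<and> i \<in> A j. (s - of_nat (q j)) * E (inc p i) (inc q j) s (x(i := y)))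
      = of_real y * ?e * ?S"
    unfolding sum_distrib_left using i by (intro sum.cong) (auto simp: E_inc_left E_inc_right)
  ultimately show ?thesis
    unfolding ibp_def using i y by (simp add: E_inc_left algebra_simps)
qed

lemma continuous_ibp:
  assumes i: "i \<in> N" and x: "\<And>i'. i' \<in> N - {i} \<Longrightarrow> x i' > 0" and y: "y > 0"
  shows "isCont (\<lambda>y. ibp p q s i (x(i := y))) y"
  unfolding ibp_def
  by (intro continuous_intros has_vector_derivative_continuous[OF E_has_vector_derivative[OF assms]])

text \<open>If the slice is not integrable, then its Bochner integral is \<open>0\<close> by convention, which is the
  required value.\<close>

lemma integral_slice_ibp:
  assumes i: "i \<in> N" and cv: "converges p q \<sigma>" and \<sigma>: "\<sigma> \<le> 0" "\<sigma> \<le> Re s"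
  shows "(\<integral>y. ibp p q s i (x(i := y)) \<partial>lborel) = 0"
proof (cases "integrable lborel (\<lambda>y. ibp p q s i (x(i := y))) \<and> (\<forall>i'\<in>N - {i}. x i' > 0)")
  case False
  then consider "\<not> integrable lborel (\<lambda>y. ibp p q s i (x(i := y)))" | i' where "i' \<in> N - {i}" "\<not> x i' > 0"
    by blast
  thus ?thesis
  proof cases
    case 2
    hence "\<not> pos (x(i := y))" for y by (auto simp: pos_def)
    hence "ibp p q s i (x(i := y)) = 0" for y by (simp add: ibp_def E_def weight_def)
    thus ?thesis by simp
  qed (simp add: not_integrable_integral_eq)
next
  case True
  hence int: "integrable lborel (\<lambda>y. ibp p q s i (x(i := y)))" and x: "\<And>i'. i' \<in> N - {i} \<Longrightarrow> x i' > 0"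
    by auto
  obtain C \<delta> where C: "C \<ge> 0" "\<delta> > 0" "\<And>u. norm (E p q s u) \<le> C * (\<Prod>i\<in>N. decay \<delta> (u i))"
    using norm_E_le[OF cv \<sigma>] by blast
  define C' where "C' = C * (\<Prod>i'\<in>N - {i}. decay \<delta> (x i'))"
  have bound: "norm (of_real y * E p q s (x(i := y))) \<le> C' * (y * decay \<delta> y)" if "y > 0" for y
  proof -
    have "(\<Prod>i'\<in>N. decay \<delta> ((x(i := y)) i')) = decay \<delta> y * (\<Prod>i'\<in>N - {i}. decay \<delta> (x i'))"
      using i by (subst prod.remove[of N i]) (auto intro!: prod.cong)
    hence "norm (E p q s (x(i := y))) \<le> C' * decay \<delta> y"
      using C(3)[of "x(i := y)"] by (simp add: C'_def mult_ac)
    hence "y * norm (E p q s (x(i := y))) \<le> y * (C' * decay \<delta> y)"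
      using that by (intro mult_left_mono) auto
    thus ?thesis using that by (simp add: norm_mult mult_ac)
  qed
  have lim: "((\<lambda>y. of_real y * E p q s (x(i := y))) \<longlongrightarrow> 0) F"
    if "((\<lambda>y. y * decay \<delta> y) \<longlongrightarrow> 0) F" "eventually (\<lambda>y. y > 0) F" for F
  proof (rule Lim_null_comparison)
    show "eventually (\<lambda>y. norm (of_real y * E p q s (x(i := y))) \<le> C' * (y * decay \<delta> y)) F"
      using that(2) by eventually_elim (rule bound)
    show "((\<lambda>y. C' * (y * decay \<delta> y)) \<longlongrightarrow> 0) F"
      using tendsto_mult[OF tendsto_const that(1)] by simp
  qed
  have "(LBINT y=ereal 0..\<infinity>. ibp p q s i (x(i := y))) = 0 - 0"
  proof (rule interval_integral_FTC_integrable[where F = "\<lambda>y. of_real y * E p q s (x(i := y))"])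
    show "set_integrable lborel (einterval (ereal 0) \<infinity>) (\<lambda>y. ibp p q s i (x(i := y)))"
      unfolding set_integrable_def using int by (intro integrable_mult_indicator) auto
  qed (use tendsto_times_decay[OF C(2)] in
       \<open>auto intro!: ibp_has_vector_derivative continuous_ibp i x lim
          simp: ereal_tendsto_simps eventually_at_right_less eventually_gt_at_top\<close>)
  moreover have "(LBINT y=ereal 0..\<infinity>. ibp p q s i (x(i := y))) = (\<integral>y. ibp p q s i (x(i := y)) \<partial>lborel)"
  proof -
    have "ibp p q s i (x(i := y)) = 0" if "y \<le> 0" for y
    proof -
      have "\<not> pos (x(i := y))" using that i by (auto simp: pos_def not_less intro!: bexI[of _ i])
      thus ?thesis by (simp add: ibp_def E_def weight_def)
    qed
    thus ?thesis
      by (auto simp: interval_lebesgue_integral_def set_lebesgue_integral_def indicator_def not_less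
           intro!: Bochner_Integration.integral_cong)
  qed
  ultimately show ?thesis by simp
qed

text \<open>Fubini in the coordinate \<open>i\<close>: \<open>ibp\<close> is a total derivative with
  vanishing slices, and the convergence assumptions allow its integral to be split term by
  term.\<close>

lemma integration_by_parts:
  assumes i: "i \<in> N" and \<sigma>: "\<sigma> \<le> 0" "\<sigma> \<le> Re s"
    and cv: "converges p q \<sigma>" "converges (inc p i) q \<sigma>" "\<And>j. j \<in> K \<Longrightarrow> i \<in> A j \<Longrightarrow> converges (inc p i) (inc q j) \<sigma>"
  shows "of_nat (Suc (p i)) * J p q s = J (inc p i) q s
    - (\<Sum>j | j \<in> K \<and> i \<in> A j. (s - of_nat (q j)) * J (inc p i) (inc q j) s)"
proof -
  note int = integrable_E[OF cv(1) \<sigma>] integrable_E[OF cv(2) \<sigma>] integrable_E[OF cv(3) \<sigma>]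
  have int_ibp: "integrable MN (ibp p q s i)"
    unfolding ibp_def[abs_def]
    by (intro Bochner_Integration.integrable_diff Bochner_Integration.integrable_add
         Bochner_Integration.integrable_sum integrable_mult_right int) auto
  have N: "insert i (N - {i}) = N" using i by auto
  have "integral\<^sup>L MN (ibp p q s i) = (\<integral>x. (\<integral>y. ibp p q s i (x(i := y)) \<partial>lborel) \<partial>PiM (N - {i}) (\<lambda>_. lborel))"
    using lborel_product.product_integral_insert[of "N - {i}" i "ibp p q s i"] int_ibp
    unfolding N by auto
  also have "\<dots> = 0" by (simp add: integral_slice_ibp[OF i cv(1) \<sigma>])
  finally have "integral\<^sup>L MN (ibp p q s i) = 0" .
  moreover have "integral\<^sup>L MN (ibp p q s i) = of_nat (Suc (p i)) * J p q s
     + (\<Sum>j | j \<in> K \<and> i \<in> A j. (s - of_nat (q j)) * J (inc p i) (inc q j) s) - J (inc p i) q s"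
    unfolding ibp_def[abs_def] J_def using int
    by (subst Bochner_Integration.integral_diff Bochner_Integration.integral_add
         Bochner_Integration.integral_sum integral_mult_right_zero;
       (intro Bochner_Integration.integrable_add Bochner_Integration.integrable_sum integrable_mult_right)?; auto)+
  ultimately show ?thesis by (simp add: algebra_simps)
qed

lemma J_form_sum:
  assumes j: "j \<in> K" and \<sigma>: "\<sigma> \<le> 0" "\<sigma> \<le> Re s"
    and cv: "\<And>i. i \<in> A j \<Longrightarrow> converges (inc p i) (inc q j) \<sigma>"
  shows "(\<Sum>i\<in>A j. J (inc p i) (inc q j) s) = J p q s"
  unfolding J_def
  by (subst Bochner_Integration.integral_sum[symmetric])
     (auto simp: sum_E_inc[OF j] intro!: integrable_E[OF cv \<sigma>])

section \<open>Orders of vanishing and the Euler identity\<close>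

definition admissible :: "('i \<Rightarrow> nat) \<Rightarrow> ('j \<Rightarrow> nat) \<Rightarrow> bool" where
  "admissible p q \<longleftrightarrow> (\<forall>S\<subseteq>N. (\<Sum>j | j \<in> K \<and> A j \<subseteq> S. q j) \<le> (\<Sum>i\<in>S. p i))"

text \<open>The order of vanishing along \<open>S\<close> of the monomial divided by the powers of
  the forms: only forms supported in \<open>S\<close> become small together with the coordinates in
  \<open>S\<close>. For admissible exponents the truncated subtraction is exact.\<close>

definition excess :: "('i \<Rightarrow> nat) \<Rightarrow> ('j \<Rightarrow> nat) \<Rightarrow> 'i set \<Rightarrow> nat" where
  "excess p q S = (\<Sum>i\<in>S. p i) - (\<Sum>j | j \<in> K \<and> A j \<subseteq> S. q j)"

text \<open>The zeros of the divisors in \<open>facet_identity\<close>, with every \<open>l\<close>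
  allowed in place of the excesses that actually occur. The set thus depends neither on the half
  plane nor on the order in which the sets are treated.\<close>

definition candidate_poles :: "complex set" where
  "candidate_poles = {z. \<exists>S l. S \<subseteq> N \<and> num_inside S > 0 \<and> of_nat (card S + l) + z * of_nat (num_inside S) = 0}"

lemma sum_inc_left: "finite S \<Longrightarrow> (\<Sum>i'\<in>S. inc p i i') = (\<Sum>i'\<in>S. p i') + (if i \<in> S then 1 else 0)"
  by (cases "i \<in> S") (auto simp: sum.remove intro!: sum.cong)

lemma sum_inc_right:
  "(\<Sum>j' | j' \<in> K \<and> A j' \<subseteq> S. inc q j j') = (\<Sum>j' | j' \<in> K \<and> A j' \<subseteq> S. q j') + (if j \<in> K \<and> A j \<subseteq> S then 1 else 0)"
  using sum_inc_left[of "{j' \<in> K. A j' \<subseteq> S}" q j] by simp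

lemma admissible_inc_left:
  assumes "admissible p q" shows "admissible (inc p i) q"
  unfolding admissible_def
proof (intro allI impI)
  fix S assume S: "S \<subseteq> N"
  have "(\<Sum>j | j \<in> K \<and> A j \<subseteq> S. q j) \<le> sum p S" using assms S by (auto simp: admissible_def)
  thus "(\<Sum>j | j \<in> K \<and> A j \<subseteq> S. q j) \<le> sum (inc p i) S"
    unfolding sum_inc_left[OF finite_subset[OF S finite_N]] by (rule trans_le_add1)
qed

text \<open>A set that contains \<open>A j\<close> also contains \<open>i\<close>, so the new power
  of the form is always compensated by the new power of \<open>u i\<close>.\<close>

lemma admissible_inc_both:
  assumes "admissible p q" "j \<in> K" "i \<in> A j"
  shows "admissible (inc p i) (inc q j)"
  unfolding admissible_def
proof (intro allI impI)
  fix S assume S: "S \<subseteq> N"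
  have "(\<Sum>j | j \<in> K \<and> A j \<subseteq> S. q j) \<le> sum p S" using assms(1) S by (auto simp: admissible_def)
  thus "sum (inc q j) {j \<in> K. A j \<subseteq> S} \<le> sum (inc p i) S"
    using assms sum_inc_left[OF finite_subset[OF S finite_N], of p i] sum_inc_right[of q j S]
    by auto
qed

lemma excess_inc_left:
  assumes "admissible p q" "S \<subseteq> N"
  shows "excess (inc p i) q S = excess p q S + (if i \<in> S then 1 else 0)"
proof -
  have "(\<Sum>j | j \<in> K \<and> A j \<subseteq> S. q j) \<le> sum p S" using assms by (auto simp: admissible_def)
  thus ?thesis
    using sum_inc_left[OF finite_subset[OF assms(2) finite_N], of p i] by (simp add: excess_def)
qed

text \<open>The order along \<open>S\<close> rises exactly in the terms that
  \<open>facet_identity\<close> keeps on its right side: those with \<open>i\<close> in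
  \<open>S\<close> and a form sticking out of \<open>S\<close>.\<close>

lemma excess_inc_both:
  assumes "admissible p q" "S \<subseteq> N" "j \<in> K" "i \<in> A j"
  shows "excess (inc p i) (inc q j) S = excess p q S + (if i \<in> S \<and> \<not> A j \<subseteq> S then 1 else 0)"
proof -
  have "(\<Sum>j | j \<in> K \<and> A j \<subseteq> S. q j) \<le> sum p S" using assms by (auto simp: admissible_def)
  thus ?thesis
    using sum_inc_left[OF finite_subset[OF assms(2) finite_N], of p i] sum_inc_right[of q j S] assms(3,4)
    by (auto simp: excess_def)
qed

lemma of_nat_excess:
  assumes "admissible p q" "S \<subseteq> N"
  shows "(of_nat (excess p q S) :: 'a :: ring_1)
    = (\<Sum>i\<in>S. of_nat (p i)) - (\<Sum>j | j \<in> K \<and> A j \<subseteq> S. of_nat (q j))"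
  using assms by (simp add: excess_def admissible_def of_nat_diff)

text \<open>\<open>few_forms\<close> gives at most \<open>card S\<close> forms inside
  \<open>S\<close>, each with exponent above \<open>-1\<close>, against \<open>card S\<close> from
  the volume element; the remaining powers contribute the nonnegative excess.\<close>

lemma converges_admissible:
  assumes "admissible p q" "-1 < \<sigma>" "\<sigma> \<le> 0"
  shows "converges p q \<sigma>"
  unfolding converges_def
proof (intro allI impI)
  fix S assume S: "S \<subseteq> N" "S \<noteq> {}"
  have "card S > 0" using S finite_subset[OF S(1) finite_N] by (simp add: card_gt_0_iff)
  hence "(- \<sigma>) * real (card S) < 1 * real (card S)" using assms by (intro mult_strict_right_mono) auto
  moreover have "(- \<sigma>) * real (num_inside S) \<le> (- \<sigma>) * real (card S)"
    using few_forms[OF S(1)] assms by (intro mult_left_mono) (auto simp: num_inside_def)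
  moreover have "(0::real) \<le> excess p q S" by simp
  ultimately show "(\<Sum>j | j \<in> K \<and> A j \<subseteq> S. real (q j) - \<sigma>) < (\<Sum>i\<in>S. real (p i) + 1)"
    unfolding of_nat_excess[OF assms(1) S(1)] by (simp add: sum.distrib sum_subtractf num_inside_def mult.commute)
qed

lemma converges_large_excess:
  assumes "admissible p q" "\<And>S. S \<subseteq> N \<Longrightarrow> num_inside S > 0 \<Longrightarrow> M * real (num_inside S) < real (card S + excess p q S)"
  shows "converges p q (- M)"
  unfolding converges_def
proof (intro allI impI)
  fix S assume S: "S \<subseteq> N" "S \<noteq> {}"
  have "card S > 0" using S finite_subset[OF S(1) finite_N] by (simp add: card_gt_0_iff)
  hence "M * real (num_inside S) < real (card S + excess p q S)"
    using assms(2)[OF S(1)] by (cases "num_inside S = 0") auto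
  thus "(\<Sum>j | j \<in> K \<and> A j \<subseteq> S. real (q j) - - M) < (\<Sum>i\<in>S. real (p i) + 1)"
    unfolding of_nat_add of_nat_excess[OF assms(1) S(1)] by (simp add: sum.distrib sum_subtractf num_inside_def mult.commute)
qed

text \<open>Integrating by parts along the Euler field of the coordinates in \<open>S\<close>. Every integral on the
  right vanishes to higher order along \<open>S\<close>, and to no lower order along any other set.\<close>

lemma facet_identity:
  assumes ad: "admissible p q" and S: "S \<subseteq> N" and s: "Re s > -1"
  shows "(of_nat (card S + excess p q S) + s * of_nat (num_inside S)) * J p q s
    = (\<Sum>i\<in>S. J (inc p i) q s)
      - (\<Sum>i\<in>S. \<Sum>j | j \<in> K \<and> i \<in> A j \<and> \<not> A j \<subseteq> S. (s - of_nat (q j)) * J (inc p i) (inc q j) s)"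
proof -
  have finS: "finite S" using S finite_N by (rule finite_subset)
  \<comment> \<open>The convergence lemmas require a bound that is nonpositive and at most
    \<open>Re s\<close>; the minimum with 0 stays above \<open>-1\<close>.\<close>
  define \<sigma> where "\<sigma> = min 0 (Re s)"
  have \<sigma>: "\<sigma> \<le> 0" "\<sigma> \<le> Re s" "-1 < \<sigma>" using s by (auto simp: \<sigma>_def)
  define T where "T = (\<lambda>i j. (s - of_nat (q j)) * J (inc p i) (inc q j) s)"
  define B where "B = (\<lambda>i. J (inc p i) q s)"
  have cv: "converges p q \<sigma>" "\<And>i. converges (inc p i) q \<sigma>" "\<And>i j. j \<in> K \<Longrightarrow> i \<in> A j \<Longrightarrow> converges (inc p i) (inc q j) \<sigma>"
    using converges_admissible[OF _ \<sigma>(3,1)] ad admissible_inc_left admissible_inc_both by auto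
  have "(\<Sum>i\<in>S. of_nat (Suc (p i)) * J p q s)
     = (\<Sum>i\<in>S. B i - (\<Sum>j | j \<in> K \<and> i \<in> A j. T i j))"
    unfolding T_def B_def
    using S by (intro sum.cong refl integration_by_parts[OF _ \<sigma>(1,2)] cv) auto
  also have "\<dots> = (\<Sum>i\<in>S. B i) - (\<Sum>i\<in>S. \<Sum>j | j \<in> K \<and> i \<in> A j. T i j)"
    by (rule sum_subtractf)
  also have "(\<Sum>i\<in>S. \<Sum>j | j \<in> K \<and> i \<in> A j. T i j)
     = (\<Sum>i\<in>S. \<Sum>j | j \<in> K \<and> (i \<in> A j \<and> A j \<subseteq> S). T i j)
       + (\<Sum>i\<in>S. \<Sum>j | j \<in> K \<and> i \<in> A j \<and> \<not> A j \<subseteq> S. T i j)"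
    unfolding sum.distrib[symmetric]
    by (intro sum.cong refl, subst sum.union_disjoint[symmetric]) (auto intro!: sum.cong)
  \<comment> \<open>For a fixed form inside \<open>S\<close> the index \<open>i\<close> runs over
    all of \<open>A j\<close>, so \<open>J_form_sum\<close> collapses the inner sum to
    \<open>J p q s\<close>. Moved to the left, these terms supply \<open>s * num_inside S\<close>
    and the \<open>q\<close> part of the excess.\<close>
  also have "(\<Sum>i\<in>S. \<Sum>j | j \<in> K \<and> (i \<in> A j \<and> A j \<subseteq> S). T i j)
     = (\<Sum>j\<in>K. \<Sum>i | i \<in> S \<and> (i \<in> A j \<and> A j \<subseteq> S). T i j)"
    by (rule sum.swap_restrict[OF finS finite_K])
  also have "\<dots> = (\<Sum>j\<in>K. if A j \<subseteq> S then (s - of_nat (q j)) * J p q s else 0)"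
  proof (intro sum.cong refl)
    fix j assume j: "j \<in> K"
    show "(\<Sum>i | i \<in> S \<and> (i \<in> A j \<and> A j \<subseteq> S). T i j) = (if A j \<subseteq> S then (s - of_nat (q j)) * J p q s else 0)"
    proof (cases "A j \<subseteq> S")
      case True
      hence "{i. i \<in> S \<and> i \<in> A j \<and> A j \<subseteq> S} = A j" by auto
      with True show ?thesis unfolding T_def
        by (simp add: J_form_sum[OF j \<sigma>(1,2) cv(3)[OF j]] flip: sum_distrib_left)
    qed simp
  qed
  also have "\<dots> = (\<Sum>j | j \<in> K \<and> A j \<subseteq> S. (s - of_nat (q j)) * J p q s)"
    by (simp add: sum.If_cases Int_def)
  finally have eq: "(\<Sum>i\<in>S. of_nat (Suc (p i)) * J p q s) = (\<Sum>i\<in>S. B i)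
      - ((\<Sum>j | j \<in> K \<and> A j \<subseteq> S. (s - of_nat (q j)) * J p q s)
        + (\<Sum>i\<in>S. \<Sum>j | j \<in> K \<and> i \<in> A j \<and> \<not> A j \<subseteq> S. T i j))" .
  have "(\<Sum>i\<in>S. of_nat (Suc (p i))) * J p q s + (\<Sum>j | j \<in> K \<and> A j \<subseteq> S. s - of_nat (q j)) * J p q s
    = (\<Sum>i\<in>S. B i) - (\<Sum>i\<in>S. \<Sum>j | j \<in> K \<and> i \<in> A j \<and> \<not> A j \<subseteq> S. T i j)"
    unfolding sum_distrib_right eq by simp
  moreover have "of_nat (card S + excess p q S) + s * of_nat (num_inside S)
     = (\<Sum>i\<in>S. of_nat (Suc (p i))) + (\<Sum>j | j \<in> K \<and> A j \<subseteq> S. s - of_nat (q j))"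
    unfolding of_nat_add of_nat_excess[OF ad S]
    by (simp add: sum.distrib sum_subtractf num_inside_def mult.commute)
  ultimately show ?thesis unfolding T_def B_def by (simp add: distrib_right)
qed

section \<open>Meromorphic continuation by raising the orders\<close>

definition extends :: "real \<Rightarrow> (complex \<Rightarrow> complex) \<Rightarrow> (complex \<Rightarrow> complex) \<Rightarrow> bool" where
  "extends M f g \<longleftrightarrow> g meromorphic_on {z. Re z > - M} \<and>
     (\<forall>z. Re z > - M \<longrightarrow> z \<notin> candidate_poles \<longrightarrow> g analytic_on {z}) \<and> (\<forall>z. Re z > - 1 \<longrightarrow> g z = f z)"

lemma extends_diff: "extends M f g \<Longrightarrow> extends M f' g' \<Longrightarrow> extends M (\<lambda>z. f z - f' z) (\<lambda>z. g z - g' z)"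
  by (auto simp: extends_def intro!: meromorphic_intros analytic_intros)

lemma extends_sum: "(\<And>x. x \<in> X \<Longrightarrow> extends M (f x) (g x)) \<Longrightarrow> extends M (\<lambda>z. \<Sum>x\<in>X. f x z) (\<lambda>z. \<Sum>x\<in>X. g x z)"
  by (auto simp: extends_def intro!: meromorphic_intros analytic_intros sum.cong)

lemma extends_mult: "h analytic_on UNIV \<Longrightarrow> extends M f g \<Longrightarrow> extends M (\<lambda>z. h z * f z) (\<lambda>z. h z * g z)"
  using analytic_on_imp_meromorphic_on[OF analytic_on_subset[of h UNIV "{z. Re z > - M}"]]
    analytic_on_subset[of h UNIV]
  by (auto simp: extends_def intro!: meromorphic_intros analytic_intros)

text \<open>At a candidate pole \<open>- Re z\<close> is a quotient of \<open>card S + l\<close> by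
  the number of forms in \<open>S\<close>, which is at most \<open>card S\<close>. For
  \<open>s = 2 * H - 2\<close> this keeps the poles out of \<open>Re H > 1/2\<close>.\<close>

lemma Re_candidate_poles:
  assumes "z \<in> candidate_poles" shows "Re z \<le> - 1"
proof -
  obtain S l where S: "S \<subseteq> N" "num_inside S > 0" "of_nat (card S + l) + z * of_nat (num_inside S) = 0"
    using assms by (auto simp: candidate_poles_def)
  have "Re (of_nat (card S + l) + z * of_nat (num_inside S)) = 0" by (simp only: S(3) zero_complex.simps)
  hence "real (card S) + l + Re z * num_inside S = 0" by simp
  moreover have "real (num_inside S) \<le> real (card S)" using few_forms[OF S(1)] by (simp add: num_inside_def)
  ultimately have "Re z * real (num_inside S) \<le> (- 1) * real (num_inside S)" by simp
  thus ?thesis using S(2) by (subst (asm) mult_le_cancel_right) auto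
qed

lemma extends_divide:
  assumes S: "S \<subseteq> N" "num_inside S > 0" and g: "extends M (\<lambda>z. (of_nat (card S + l) + z * of_nat (num_inside S)) * f z) g"
  shows "extends M f (\<lambda>z. g z / (of_nat (card S + l) + z * of_nat (num_inside S)))"
  unfolding extends_def
proof (intro conjI allI impI)
  show "(\<lambda>z. g z / (of_nat (card S + l) + z * of_nat (num_inside S))) meromorphic_on {z. Re z > - M}"
    using g by (auto simp: extends_def intro!: meromorphic_intros)
  have nz: "of_nat (card S + l) + z * of_nat (num_inside S) \<noteq> 0" if "z \<notin> candidate_poles" for z
    using S that by (auto simp: candidate_poles_def)
  show "(\<lambda>z. g z / (of_nat (card S + l) + z * of_nat (num_inside S))) analytic_on {z}"
    if "Re z > - M" "z \<notin> candidate_poles" for z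
    using g that nz[OF that(2)] by (auto simp: extends_def intro!: analytic_intros)
  show "g z / (of_nat (card S + l) + z * of_nat (num_inside S)) = f z" if "Re z > - 1" for z
  proof -
    have "z \<notin> candidate_poles" using Re_candidate_poles that by force
    from nz[OF this] g that show ?thesis by (simp add: extends_def)
  qed
qed

lemma extends_cong: "extends M f g \<Longrightarrow> (\<And>z. Re z > - 1 \<Longrightarrow> f z = f' z) \<Longrightarrow> extends M f' g"
  by (auto simp: extends_def)

text \<open>The recursion terminates because orders matter only up to the cap \<open>C\<close>: each
  use of \<open>facet_identity\<close> raises the order along the chosen set and lowers it along
  none, so the total of the deficits \<open>C - excess p q S\<close> over all \<open>S\<close>
  drops. Once no set obstructs, the integral itself is holomorphic on the half plane.\<close>

lemma ex_extends_J:
  assumes M: "M \<ge> 0" and "admissible p q"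
  shows "\<exists>g. extends M (J p q) g"
proof -
  \<comment> \<open>Larger than \<open>M * num_inside S\<close> for every \<open>S\<close>, so a set
    that still obstructs convergence has excess below \<open>C\<close>, and its truncated deficit
    strictly decreases.\<close>
  define C where "C = nat \<lceil>M\<rceil> * card K + 1"
  have C: "M * num_inside S < C" for S
  proof -
    have "num_inside S \<le> card K" unfolding num_inside_def by (intro card_mono) auto
    hence "M * num_inside S \<le> nat \<lceil>M\<rceil> * card K" unfolding of_nat_mult using M
      by (intro mult_mono) auto
    thus ?thesis by (simp add: C_def)
  qed
  show ?thesis using assms(2)
  proof (induction "\<Sum>S\<in>Pow N. C - excess p q S" arbitrary: p q rule: less_induct)
    case less
    note ad = less.prems
    show ?case
    proof (cases "\<forall>S\<subseteq>N. num_inside S > 0 \<longrightarrow> M * num_inside S < card S + excess p q S")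
      case True
      hence "converges p q (- M)" using converges_large_excess[OF ad] by blast
      hence "J p q holomorphic_on {s. - M < Re s}" using M by (intro J_holomorphic) auto
      hence "J p q analytic_on {s. - M < Re s}"
        by (subst analytic_on_open) (auto simp: open_halfspace_Re_gt)
      hence "extends M (J p q) (J p q)"
        by (auto simp: extends_def analytic_on_imp_meromorphic_on intro: analytic_on_subset)
      thus ?thesis by blast
    next
      case False
      then obtain S where S: "S \<subseteq> N" "num_inside S > 0" "card S + excess p q S \<le> M * num_inside S"
        by (auto simp: not_less)
      have excess_S: "excess p q S < C" using S(3) C[of S] by linarith
      have decr: "(\<Sum>T\<in>Pow N. C - excess p' q' T) < (\<Sum>T\<in>Pow N. C - excess p q T)"
        if "\<And>T. T \<subseteq> N \<Longrightarrow> excess p q T \<le> excess p' q' T" "excess p q S < excess p' q' S" for p' q'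
      proof (rule sum_strict_mono_ex1)
        show "\<exists>T\<in>Pow N. C - excess p' q' T < C - excess p q T"
          using S(1) that(2) excess_S by (intro bexI[of _ S] diff_less_mono2) auto
      qed (use that(1) in \<open>auto intro: diff_le_mono2\<close>)
      have 1: "\<exists>g. extends M (J (inc p i) q) g" if i: "i \<in> S" for i
        using excess_inc_left[OF ad] i S(1)
        by (intro less.hyps admissible_inc_left[OF ad] decr) auto
      have 2: "\<exists>g. extends M (J (inc p i) (inc q j)) g"
        if "i \<in> S" "j \<in> K" "i \<in> A j" "\<not> A j \<subseteq> S" for i j
        using excess_inc_both[OF ad] that S(1)
        by (intro less.hyps admissible_inc_both[OF ad] decr) auto
      from 1 obtain g1 where g1: "\<And>i. i \<in> S \<Longrightarrow> extends M (J (inc p i) q) (g1 i)" by metis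
      from 2 obtain g2 where g2: "\<And>i j. i \<in> S \<Longrightarrow> j \<in> K \<Longrightarrow> i \<in> A j \<Longrightarrow> \<not> A j \<subseteq> S \<Longrightarrow>
         extends M (J (inc p i) (inc q j)) (g2 i j)" by metis
      have "extends M (\<lambda>s. (\<Sum>i\<in>S. J (inc p i) q s)
            - (\<Sum>i\<in>S. \<Sum>j | j \<in> K \<and> i \<in> A j \<and> \<not> A j \<subseteq> S. (s - of_nat (q j)) * J (inc p i) (inc q j) s))
          (\<lambda>s. (\<Sum>i\<in>S. g1 i s)
            - (\<Sum>i\<in>S. \<Sum>j | j \<in> K \<and> i \<in> A j \<and> \<not> A j \<subseteq> S. (s - of_nat (q j)) * g2 i j s))"
        by (intro extends_diff extends_sum extends_mult g1 g2 analytic_intros) auto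
      hence "extends M (\<lambda>s. (of_nat (card S + excess p q S) + s * of_nat (num_inside S)) * J p q s)
          (\<lambda>s. (\<Sum>i\<in>S. g1 i s)
            - (\<Sum>i\<in>S. \<Sum>j | j \<in> K \<and> i \<in> A j \<and> \<not> A j \<subseteq> S. (s - of_nat (q j)) * g2 i j s))"
        by (rule extends_cong) (rule facet_identity[OF ad S(1), symmetric])
      thus ?thesis using extends_divide[OF S(1,2)] by blast
    qed
  qed
qed

text \<open>Continuations to growing half planes are glued. \<open>extends\<close> leaves the values
  at candidate poles free; after \<open>remove_sings\<close> the identity theorem makes the pieces
  agree pointwise, so \<open>F z\<close> can be read off from any piece with
  \<open>m \<ge> 1\<close> whose half plane contains \<open>z\<close>.\<close>

lemma ex_meromorphic_J:
  obtains F where "F nicely_meromorphic_on UNIV" "\<And>z. z \<notin> candidate_poles \<Longrightarrow> F analytic_on {z}"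
    "\<And>z. Re z > - 1 \<Longrightarrow> F z = J (\<lambda>_. 0) (\<lambda>_. 0) z"
proof -
  let ?J = "J (\<lambda>_. 0) (\<lambda>_. 0)"
  have "\<forall>m::nat. \<exists>g. extends m ?J g" by (intro allI ex_extends_J) (auto simp: admissible_def)
  then obtain g :: "nat \<Rightarrow> complex \<Rightarrow> complex" where g: "\<And>m. extends m ?J (g m)"
    using choice[of "\<lambda>m::nat. extends m ?J"] by blast
  define h where "h = (\<lambda>m. remove_sings (g m))"
  let ?H = "\<lambda>m::nat. {z. Re z > - real m}"
  have h1: "h m nicely_meromorphic_on ?H m" for m
    unfolding h_def using g[of m] by (intro remove_sings_nicely_meromorphic) (simp add: extends_def)
  have h2: "h m analytic_on {z}" if "Re z > - real m" "z \<notin> candidate_poles" for m z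
    unfolding h_def using g[of m] that by (intro remove_sings_analytic_on) (simp_all add: extends_def)
  have h3: "h m z = ?J z" if "Re z > - 1" "m \<ge> 1" for m z
  proof -
    have "z \<notin> candidate_poles" using Re_candidate_poles that by force
    hence "g m analytic_on {z}" using g[of m] that by (auto simp: extends_def)
    thus ?thesis unfolding h_def using g[of m] that by (simp add: extends_def)
  qed
  have agree: "h m z = h m' z" if "1 \<le> m" "m \<le> m'" "Re z > - real m" for m m' z
  proof (rule nicely_meromorphic_identity[of "h m" "?H m" "h m'" "{z. Re z > - 1}" 0])
    show "h m nicely_meromorphic_on ?H m" by (rule h1)
    show "h m' nicely_meromorphic_on ?H m"
      by (rule nicely_meromorphic_on_subset[OF h1]) (use that in auto)
    show "connected (?H m)" by (intro convex_connected convex_halfspace_Re_gt)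
    show "{z. Re z > - 1} \<subseteq> ?H m" "0 \<in> {z. Re z > - 1}" using that by auto
    show "h m z = h m' z" if "z \<in> {z. Re z > - 1}" for z
      using that h3 \<open>1 \<le> m\<close> \<open>m \<le> m'\<close> by simp
  qed (use that in \<open>auto simp: open_halfspace_Re_gt\<close>)
  define m where "m = (\<lambda>z::complex. nat \<lceil>\<bar>Re z\<bar>\<rceil> + 1)"
  have m: "m z \<ge> 1" "Re z > - real (m z)" for z
  proof -
    show "Re z > - real (m z)" using of_nat_ceiling[of "\<bar>Re z\<bar>"] unfolding m_def by simp linarith
  qed (simp add: m_def)
  define F where "F = (\<lambda>z. h (m z) z)"
  have F: "F z = h n z" if "n \<ge> 1" "Re z > - real n" for n z
  proof (cases "n \<le> m z")
    case True
    show ?thesis unfolding F_def using agree[OF that(1) True that(2)] by (rule sym)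
  next
    case False
    hence "m z \<le> n" by simp
    thus ?thesis unfolding F_def using m by (intro agree) auto
  qed
  have ev: "eventually (\<lambda>w. F w = h (m z) w) (nhds z)" for z
  proof -
    have "eventually (\<lambda>w. w \<in> ?H (m z)) (nhds z)"
      using m[of z] by (intro eventually_nhds_in_open) (auto simp: open_halfspace_Re_gt)
    thus ?thesis by eventually_elim (rule F, use m in auto)
  qed
  show ?thesis
  proof (rule that[of F])
    show "F nicely_meromorphic_on UNIV"
      unfolding nicely_meromorphic_on_def
    proof (intro conjI ballI)
      have at: "h (m z) meromorphic_on {z}" for z
        using h1[of "m z"] m[of z] by (auto simp: nicely_meromorphic_on_def intro: meromorphic_on_subset)
      have "F meromorphic_on {z}" for z
        using at[of z] eventually_nhds_conv_at[of "\<lambda>w. F w = h (m z) w" z] ev[of z]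
        by (subst meromorphic_on_cong[of "{z}" F "h (m z)"]) auto
      thus "F meromorphic_on UNIV" using meromorphic_on_meromorphic_at by blast
      fix z :: complex
      have evat: "eventually (\<lambda>w. F w = h (m z) w) (at z)" and Fz: "F z = h (m z) z"
        using ev[of z] by (auto simp: eventually_nhds_conv_at)
      have "(is_pole (h (m z)) z \<and> h (m z) z = 0) \<or> (h (m z) \<midarrow>z\<rightarrow> h (m z) z)"
        using h1[of "m z"] m[of z] by (auto simp: nicely_meromorphic_on_def)
      thus "(is_pole F z \<and> F z = 0) \<or> (F \<midarrow>z\<rightarrow> F z)"
        unfolding Fz using is_pole_cong[OF evat refl] tendsto_cong[OF evat] by simp
    qed
    show "F analytic_on {z}" if "z \<notin> candidate_poles" for z
      using analytic_at_cong[OF ev refl] h2[OF m(2) that] by blast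
    show "F z = ?J z" if "Re z > - 1" for z
      unfolding F_def using h3[OF that] m by simp
  qed
qed

end

section \<open>From the exponential weight to the simplex\<close>

lemma lborel_integral_eq:
  fixes f :: "real \<Rightarrow> 'a :: euclidean_space"
  assumes [measurable]: "f \<in> borel_measurable borel" "S \<in> sets borel"
    and f: "f absolutely_integrable_on S" "(f has_integral I) S"
  shows "integrable lborel (\<lambda>x. indicator S x *\<^sub>R f x)" "(\<integral>x. indicator S x *\<^sub>R f x \<partial>lborel) = I"
proof -
  have int: "integrable lebesgue (\<lambda>x. indicator S x *\<^sub>R f x)"
    using f(1) by (simp add: set_integrable_def)
  thus "integrable lborel (\<lambda>x. indicator S x *\<^sub>R f x)"
    using integrable_completion[of "\<lambda>x. indicator S x *\<^sub>R f x" lborel] by simp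
  have "(\<integral>x. indicator S x *\<^sub>R f x \<partial>lborel) = (\<integral>x. indicator S x *\<^sub>R f x \<partial>lebesgue)"
    by (rule integral_completion[symmetric]) simp
  also have "\<dots> = integral S f"
    using set_lebesgue_integral_eq_integral(2)[OF f(1)] by (simp add: set_lebesgue_integral_def)
  also have "\<dots> = I" using f(2) by (rule integral_unique)
  finally show "(\<integral>x. indicator S x *\<^sub>R f x \<partial>lborel) = I" .
qed

lemma lborel_integral_exp_tail:
  "integrable lborel (\<lambda>r::real. indicator {c<..} r *\<^sub>R exp (- r))"
  "(\<integral>r. indicator {c<..} r *\<^sub>R exp (- r) \<partial>lborel) = exp (- c)"
proof -
  have "((\<lambda>r. exp (- r)) has_integral exp (- c)) {c..}"
    using has_integral_exp_minus_to_infinity[of 1 c] by simp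
  moreover have "negligible {r \<in> {c..} - {c<..}. exp (- r) \<noteq> 0}" "negligible {r \<in> {c<..} - {c..}. exp (- r) \<noteq> 0}"
    by (auto intro: negligible_subset[of "{c}"])
  ultimately have h: "((\<lambda>r. exp (- r)) has_integral exp (- c)) {c<..}"
    using has_integral_spike_set_eq[of "{c..}" "{c<..}" "\<lambda>r. exp (- r)" "exp (- c)"] by blast
  have "(\<lambda>r. exp (- r)) absolutely_integrable_on {c<..}"
    using h by (intro nonnegative_absolutely_integrable_1) (auto simp: has_integral_integrable)
  from lborel_integral_eq[OF _ _ this h]
  show "integrable lborel (\<lambda>r::real. indicator {c<..} r *\<^sub>R exp (- r))"
    "(\<integral>r. indicator {c<..} r *\<^sub>R exp (- r) \<partial>lborel) = exp (- c)" by simp_all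
qed

lemma lborel_integral_Gamma:
  assumes "Re z > 0"
  shows "(\<integral>r. indicator {0<..} r *\<^sub>R (complex_of_real r powr (z - 1) / of_real (exp r)) \<partial>lborel) = Gamma z"
  by (rule lborel_integral_eq(2)[OF _ _ absolutely_integrable_Gamma_integral'[OF assms] Gamma_integral_complex'[OF assms]])
     measurable

context linear_forms begin

definition simplex_fun :: "complex \<Rightarrow> real \<Rightarrow> ('i \<Rightarrow> real) \<Rightarrow> complex" where
  "simplex_fun s r u = (if pos u \<and> sum u N < r then exp (s * of_real (log_forms u)) else 0)"

definition L :: "complex \<Rightarrow> complex" where
  "L s = (\<integral>u. simplex_fun s 1 u \<partial>MN)"

lemma simplex_fun_measurable [measurable]: "simplex_fun s r \<in> borel_measurable MN"
  unfolding simplex_fun_def by measurable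

text \<open>Dilation by \<open>r\<close>: the volume element contributes \<open>card N\<close> to
  the exponent, and each of the \<open>card K\<close> forms contributes \<open>s\<close>.\<close>

lemma integral_simplex_fun:
  "(\<integral>u. simplex_fun s r u \<partial>MN)
     = (if r > 0 then of_real r powr (of_nat (card N) + of_nat (card K) * s) * L s else 0)"
proof (cases "r > 0")
  case False
  have "simplex_fun s r u = 0" for u
  proof -
    have "pos u \<Longrightarrow> 0 \<le> sum u N" by (intro sum_nonneg) (auto simp: pos_def intro: less_imp_le)
    thus ?thesis using False by (auto simp: simplex_fun_def)
  qed
  thus ?thesis using False by simp
next
  case True
  have eq: "simplex_fun s r (scale_fun N r u) = of_real r powr (of_nat (card K) * s) * simplex_fun s 1 u" for u
  proof -
    have pos: "pos (scale_fun N r u) \<longleftrightarrow> pos u"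
      using True by (auto simp: pos_def scale_fun_def zero_less_mult_iff)
    have sum: "sum (scale_fun N r u) N < r \<longleftrightarrow> sum u N < 1"
      using True by (simp add: scale_fun_def flip: sum_distrib_left)
    have "log_forms (scale_fun N r u) = card K * ln r + log_forms u" if "pos u"
    proof -
      have "form j (scale_fun N r u) = r * form j u" if "j \<in> K" for j
        using A_sub[OF that] unfolding form_def scale_fun_def sum_distrib_left
        by (intro sum.cong) auto
      hence "log_forms (scale_fun N r u) = (\<Sum>j\<in>K. ln r + ln (form j u))"
        unfolding log_forms_def using True form_pos[OF \<open>pos u\<close>]
        by (intro sum.cong refl) (simp add: ln_mult_pos)
      thus ?thesis by (simp add: sum.distrib log_forms_def)
    qed
    thus ?thesis unfolding simplex_fun_def pos sum using True
      by (auto simp: powr_def Ln_of_real distrib_left exp_add mult_ac)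
  qed
  have "(\<integral>u. simplex_fun s r u \<partial>MN) = of_real (r ^ card N) * (\<integral>u. simplex_fun s r (scale_fun N r u) \<partial>MN)"
    by (rule integral_scale_fun[OF finite_N True]) measurable
  also have "\<dots> = of_real r powr (of_nat (card N)) * of_real r powr (of_nat (card K) * s) * L s"
    using True unfolding eq L_def by (simp add: powr_nat')
  also have "\<dots> = of_real r powr (of_nat (card N) + of_nat (card K) * s) * L s"
    by (simp add: powr_add)
  finally show ?thesis using True by simp
qed

text \<open>Write \<open>exp (- sum u N)\<close> as the integral of \<open>exp (- r)\<close> over \<open>r > sum u N\<close> and use homogeneity in \<open>r\<close>.\<close>

lemma J_eq_Gamma_L:
  assumes s: "Re s > - 1" and int: "integrable MN (E (\<lambda>_. 0) (\<lambda>_. 0) s)"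
  shows "J (\<lambda>_. 0) (\<lambda>_. 0) s = Gamma (of_nat (card N) + of_nat (card K) * s + 1) * L s"
proof -
  let ?E = "E (\<lambda>_. 0) (\<lambda>_. 0) s"
  let ?z = "of_nat (card N) + of_nat (card K) * s + 1"
  interpret pair_sigma_finite MN "lborel :: real measure"
    by (intro pair_sigma_finite.intro lborel_product.sigma_finite finite_N sigma_finite_lborel)
  define f where "f = (\<lambda>u r. simplex_fun s r u * of_real (exp (- r)))"
  have f_meas [measurable]: "case_prod f \<in> borel_measurable (MN \<Otimes>\<^sub>M lborel)"
    unfolding f_def simplex_fun_def by measurable
  have f_eq: "f u = (\<lambda>r. (if pos u then exp (s * of_real (log_forms u)) else 0)
      * of_real (indicator {sum u N<..} r *\<^sub>R exp (- r)))" for u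
    by (auto simp: f_def simplex_fun_def indicator_def)
  have norm_f: "norm (f u r) = norm (if pos u then exp (s * of_real (log_forms u)) else 0)
      * (indicator {sum u N<..} r *\<^sub>R exp (- r))" for u r
    by (auto simp: f_eq norm_mult indicator_def)
  have E_eq: "?E u = (if pos u then exp (s * of_real (log_forms u)) else 0) * of_real (exp (- sum u N))" for u
    by (simp add: E_def weight_def log_weight_def)
  have inner: "integrable lborel (f u)" for u
    unfolding f_eq using lborel_integral_exp_tail(1)[of "sum u N"]
    by (intro integrable_mult_right integrable_of_real)
  have inner_eq: "(\<integral>r. f u r \<partial>lborel) = ?E u" for u
    unfolding f_eq E_eq integral_mult_right_zero integral_complex_of_real lborel_integral_exp_tail(2) ..
  have "integrable (MN \<Otimes>\<^sub>M lborel) (case_prod f)"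
  proof (rule Fubini_integrable)
    have "(\<integral>r. norm (f u r) \<partial>lborel) = norm (?E u)" for u
      unfolding norm_f integral_mult_right_zero lborel_integral_exp_tail(2) E_eq by (simp add: norm_mult)
    thus "integrable MN (\<lambda>u. \<integral>r. norm (case_prod f (u, r)) \<partial>lborel)"
      using int by simp
  qed (use inner in auto)
  from Fubini_integral[OF this]
  have "J (\<lambda>_. 0) (\<lambda>_. 0) s = (\<integral>r. (\<integral>u. f u r \<partial>MN) \<partial>lborel)"
    unfolding inner_eq J_def by simp
  also have "\<dots> = (\<integral>r. (indicator {0<..} r *\<^sub>R (complex_of_real r powr (?z - 1) / of_real (exp r))) * L s \<partial>lborel)"
  proof (rule Bochner_Integration.integral_cong[OF refl])
    fix r :: real
    have "(\<integral>u. f u r \<partial>MN) = (\<integral>u. simplex_fun s r u \<partial>MN) * of_real (exp (- r))"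
      unfolding f_def by simp
    thus "(\<integral>u. f u r \<partial>MN) = (indicator {0<..} r *\<^sub>R (complex_of_real r powr (?z - 1) / of_real (exp r))) * L s"
      unfolding integral_simplex_fun by (simp add: exp_minus divide_inverse indicator_def)
  qed
  also have "\<dots> = Gamma ?z * L s"
  proof -
    \<comment> \<open>\<open>few_forms\<close> for the full set, together with
      \<open>Re s > -1\<close>, places the argument of the Gamma integral in its half plane of
      convergence.\<close>
    have "real (card K) \<le> real (card N)" using few_forms[OF order_refl] A_sub by (simp add: Collect_conj_eq Int_absorb2 subset_iff)
    moreover have "- real (card K) \<le> real (card K) * Re s"
      using mult_left_mono[of "-1" "Re s" "real (card K)"] s by simp
    ultimately have "Re ?z > 0" by simp
    from lborel_integral_Gamma[OF this] show ?thesis by (simp only: integral_mult_left_zero)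
  qed
  finally show ?thesis .
qed

end

context linear_forms begin

lemma ex_meromorphic_L:
  "\<exists>F. F meromorphic_on UNIV \<and> (\<forall>z. z \<notin> candidate_poles \<longrightarrow> F analytic_on {z})
    \<and> (\<forall>z. Re z > - 1 \<longrightarrow> F z = L z)"
proof -
  let ?a = "\<lambda>s. of_nat (card N) + of_nat (card K) * s + 1 :: complex"
  obtain F where F: "F nicely_meromorphic_on UNIV" "\<And>z. z \<notin> candidate_poles \<Longrightarrow> F analytic_on {z}"
    "\<And>z. Re z > - 1 \<Longrightarrow> F z = J (\<lambda>_. 0) (\<lambda>_. 0) z"
    using ex_meromorphic_J by blast
  have aG: "(\<lambda>s. rGamma (?a s)) analytic_on X" for X
    by (intro analytic_intros)
  show ?thesis
  proof (intro exI[of _ "\<lambda>s. rGamma (?a s) * F s"] conjI allI impI)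
    show "(\<lambda>s. rGamma (?a s) * F s) meromorphic_on UNIV"
      by (rule meromorphic_on_mult[OF analytic_on_imp_meromorphic_on[OF aG]])
        (use F(1) in \<open>simp add: nicely_meromorphic_on_def\<close>)
    show "(\<lambda>s. rGamma (?a s) * F s) analytic_on {z}" if "z \<notin> candidate_poles" for z
      by (intro analytic_on_mult aG F(2) that)
    show "rGamma (?a z) * F z = L z" if z: "Re z > - 1" for z
    proof -
      define \<sigma> where "\<sigma> = min 0 (Re z)"
      have "converges (\<lambda>_. 0) (\<lambda>_. 0) \<sigma>"
        using z by (intro converges_admissible) (auto simp: \<sigma>_def admissible_def)
      hence "integrable MN (E (\<lambda>_. 0) (\<lambda>_. 0) z)"
        by (rule integrable_E) (auto simp: \<sigma>_def)
      hence J: "J (\<lambda>_. 0) (\<lambda>_. 0) z = Gamma (?a z) * L z"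
        by (rule J_eq_Gamma_L[OF z])
      have "num_inside N \<le> card N" unfolding num_inside_def by (rule few_forms) simp
      moreover have "num_inside N = card K" unfolding num_inside_def using A_sub by (intro arg_cong[of _ _ card]) auto
      moreover have "- real (card K) \<le> real (card K) * Re z"
        using mult_left_mono[of "-1" "Re z" "real (card K)"] z by simp
      ultimately have "Re (?a z) > 0" by simp
      hence "?a z \<notin> \<int>\<^sub>\<le>\<^sub>0"
        by (metis Re_complex_of_real nonpos_Ints_cases not_less of_int_le_0_iff of_real_of_int_eq)
      hence "rGamma (?a z) * Gamma (?a z) = 1"
        by (simp add: rGamma_inverse_Gamma Gamma_eq_zero_iff)
      thus ?thesis unfolding F(3)[OF z] J by (simp flip: mult.assoc)
    qed
  qed
qed

end

section \<open>Gap coordinates on the simplex\<close>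

lemma sum_gaps:
  assumes "1 \<le> a" "a \<le> b" "b \<le> n"
  shows "(\<Sum>i=a+1..b. gaps n s i) = s b - s a"
  using assms(2,3)
proof (induction b rule: dec_induct)
  case (step b)
  hence "{a+1..Suc b} = insert (Suc b) {a+1..b}" by auto
  thus ?case using step assms(1) by (simp add: gaps_def)
qed simp

lemma sum_gaps_all:
  assumes "1 \<le> b" "b \<le> n"
  shows "(\<Sum>i=1..b. gaps n s i) = s b"
proof -
  have "{1..b} = insert 1 {1+1..b}" using assms by auto
  hence "(\<Sum>i=1..b. gaps n s i) = gaps n s 1 + (\<Sum>i=1+1..b. gaps n s i)" by simp
  thus ?thesis using sum_gaps[of 1 b n s] assms by (simp add: gaps_def)
qed

text \<open>Monotonicity is positivity of the gaps after the first. The first gap is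
  \<open>s 1\<close> and the total is \<open>s n\<close>, so for monotone points the remaining two
  conditions say that all coordinates lie between 0 and 1.\<close>

lemma open_simplex_iff_gaps:
  assumes "n \<ge> 1" "s \<in> space (PiM {1..n} (\<lambda>_. lborel :: real measure))"
  shows "s \<in> open_simplex n \<longleftrightarrow> (\<forall>i\<in>{1..n}. 0 < gaps n s i) \<and> (\<Sum>i=1..n. gaps n s i) < 1"
proof -
  have ext: "s \<in> {1..n} \<rightarrow>\<^sub>E UNIV" using assms(2) by (simp add: space_PiM)
  have tot: "(\<Sum>i=1..n. gaps n s i) = s n" using sum_gaps_all[of n n s] assms(1) by simp
  show ?thesis
  proof
    assume s: "s \<in> open_simplex n"
    have mono: "s x < s y" if "x \<in> {1..n}" "y \<in> {1..n}" "x < y" for x y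
      using s that by (auto simp: open_simplex_def strict_mono_on_def)
    have "0 < gaps n s i" if i: "i \<in> {1..n}" for i
    proof (cases "i = 1")
      case True
      thus ?thesis using s i by (simp add: gaps_def open_simplex_def)
    next
      case False
      thus ?thesis using mono[of "i - 1" i] i by (auto simp: gaps_def)
    qed
    moreover have "s n < 1" using s assms(1) by (auto simp: open_simplex_def)
    ultimately show "(\<forall>i\<in>{1..n}. 0 < gaps n s i) \<and> (\<Sum>i=1..n. gaps n s i) < 1" unfolding tot by blast
  next
    assume g: "(\<forall>i\<in>{1..n}. 0 < gaps n s i) \<and> (\<Sum>i=1..n. gaps n s i) < 1"
    have mono: "s x < s y" if "x \<in> {1..n}" "y \<in> {1..n}" "x < y" for x y
    proof -
      have "0 < (\<Sum>i=x+1..y. gaps n s i)" using g that by (intro sum_pos) auto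
      thus ?thesis using sum_gaps[of x y n s] that by simp
    qed
    have "0 < s i" if "i \<in> {1..n}" for i
    proof -
      have "0 < (\<Sum>j=1..i. gaps n s j)" using g that by (intro sum_pos) auto
      thus ?thesis using sum_gaps_all[of i n s] that by simp
    qed
    moreover have "s i < 1" if "i \<in> {1..n}" for i
      using mono[of i n] that g tot by (cases "i = n") auto
    ultimately show "s \<in> open_simplex n"
      using ext mono by (auto simp: open_simplex_def strict_mono_on_def)
  qed
qed

section \<open>Pair partitions\<close>

text \<open>Of the maximality of a component only the left end is kept, because \<open>Aug\<close>
  looks only at the left neighbour. For \<open>a = 1\<close> that neighbour is 0 and lies outside
  the ground set.\<close>

lemma componentE:
  assumes "I \<in> components_of_set k S"
  obtains a b where "1 \<le> a" "a \<le> b" "b \<le> 2 * k" "I = {a..b}" "I \<subseteq> S" "a - 1 \<notin> S \<or> a = 1"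
proof -
  have I: "subinterval k I" "I \<subseteq> S" "\<And>J. subinterval k J \<Longrightarrow> I \<subseteq> J \<Longrightarrow> J \<subseteq> S \<Longrightarrow> J = I"
    using assms by (auto simp: components_of_set_def)
  obtain a b where ab: "1 \<le> a" "a \<le> b" "b \<le> 2 * k" "I = {a..b}"
    using I(1) by (auto simp: subinterval_def)
  have "a - 1 \<notin> S \<or> a = 1"
  proof (rule ccontr)
    assume c: "\<not> (a - 1 \<notin> S \<or> a = 1)"
    have "{a - 1..b} \<subseteq> S"
    proof
      fix x assume "x \<in> {a - 1..b}"
      hence "x = a - 1 \<or> x \<in> I" using ab by auto
      thus "x \<in> S" using c I(2) by auto
    qed
    moreover have "subinterval k {a - 1..b}"
      unfolding subinterval_def using c ab by (intro exI[of _ "a - 1"] exI[of _ b]) auto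
    ultimately have "{a - 1..b} = I" by (intro I(3)) (auto simp: ab)
    moreover have "a - 1 \<in> {a - 1..b}" "a - 1 \<notin> I" using ab by auto
    ultimately show False by blast
  qed
  with ab I(2) show ?thesis using that by blast
qed

lemma subinterval_subset_component:
  assumes "subinterval k I" "I \<subseteq> S"
  shows "\<exists>C\<in>components_of_set k S. I \<subseteq> C"
proof -
  let ?X = "{J. subinterval k J \<and> I \<subseteq> J \<and> J \<subseteq> S}"
  have "?X \<subseteq> Pow {1..2*k}" by (auto simp: subinterval_def)
  hence fin: "finite ?X" by (rule finite_subset) simp
  have ne: "?X \<noteq> {}" using assms by blast
  obtain C where C: "C \<in> ?X" "\<forall>J\<in>?X. C \<le> J \<longrightarrow> C = J"
    using finite_has_maximal[OF fin ne] by (rule bexE)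
  have "C \<in> components_of_set k S"
    unfolding components_of_set_def
  proof (intro CollectI conjI allI impI)
    show "subinterval k C" "C \<subseteq> S" using C(1) by auto
    fix J assume J: "subinterval k J \<and> C \<subseteq> J \<and> J \<subseteq> S"
    hence "J \<in> ?X" using C(1) by auto
    hence "C = J" using C(2) J by simp
    thus "J = C" by simp
  qed
  with C(1) show ?thesis by blast
qed

text \<open>The union of two intervals with a common point is again an interval, so by maximality
  both components equal the union.\<close>

lemma component_unique:
  assumes I: "I \<in> components_of_set k S" and J: "J \<in> components_of_set k S" and x: "x \<in> I" "x \<in> J"
  shows "I = J"
proof -
  obtain a b where ab: "1 \<le> a" "a \<le> b" "b \<le> 2 * k" "I = {a..b}" "I \<subseteq> S" using componentE[OF I] .
  obtain c d where cd: "1 \<le> c" "c \<le> d" "d \<le> 2 * k" "J = {c..d}" "J \<subseteq> S" using componentE[OF J] .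
  have "I \<union> J = {min a c..max b d}" using x ab cd by (auto simp: min_def max_def)
  hence sub: "subinterval k (I \<union> J)"
    unfolding subinterval_def using ab cd by (intro exI[of _ "min a c"] exI[of _ "max b d"]) auto
  have "I \<union> J = I" "I \<union> J = J"
    using I J sub ab cd by (auto simp only: components_of_set_def mem_Collect_eq Un_upper1 Un_upper2 Un_least)
  thus ?thesis by simp
qed

section \<open>Blocks as linear forms in the gaps\<close>

locale pairing =
  fixes k :: nat and P :: "nat set set" and j1 j2 :: "nat \<Rightarrow> nat"
  assumes k: "k \<ge> 1" and pp: "pair_partition k P" and P: "P = (\<lambda>l. {j1 l, j2 l}) ` {1..k}"
begin

lemma part: "partition_on {1..2*k} P"
  using pp by (simp add: pair_partition_def)

definition lo :: "nat \<Rightarrow> nat" where "lo l = min (j1 l) (j2 l)"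
definition hi :: "nat \<Rightarrow> nat" where "hi l = max (j1 l) (j2 l)"

lemma block: "{lo l, hi l} = {j1 l, j2 l}"
  by (auto simp: lo_def hi_def min_def max_def)

lemma block_in_P: "l \<in> {1..k} \<Longrightarrow> {lo l, hi l} \<in> P"
  unfolding block P by (rule imageI)

lemma inj_blocks: "inj_on (\<lambda>l. {lo l, hi l}) {1..k}"
proof -
  have "card ((\<lambda>l. {j1 l, j2 l}) ` {1..k}) = card {1..k}"
    unfolding P[symmetric] using pp by (simp add: pair_partition_def)
  thus ?thesis unfolding block by (rule eq_card_imp_inj_on[rotated]) simp
qed

lemma lo_hi: "l \<in> {1..k} \<Longrightarrow> 1 \<le> lo l \<and> lo l < hi l \<and> hi l \<le> 2 * k"
proof -
  assume l: "l \<in> {1..k}"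
  have "card {lo l, hi l} = 2" "{lo l, hi l} \<subseteq> {1..2*k}"
    using block_in_P[OF l] pp by (auto simp: pair_partition_def partition_on_def)
  moreover have "lo l \<le> hi l" by (simp add: lo_def hi_def)
  ultimately show ?thesis by (cases "lo l = hi l") auto
qed

lemma blocks_disjoint:
  assumes "l \<in> {1..k}" "l' \<in> {1..k}" "x \<in> {lo l, hi l}" "x \<in> {lo l', hi l'}"
  shows "l = l'"
proof -
  have "{lo l, hi l} = {lo l', hi l'}"
  proof (rule ccontr)
    assume "{lo l, hi l} \<noteq> {lo l', hi l'}"
    hence "{lo l, hi l} \<inter> {lo l', hi l'} = {}"
      using disjointD[OF partition_onD2[OF part] block_in_P[OF assms(1)] block_in_P[OF assms(2)]] by blast
    thus False using assms(3,4) by blast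
  qed
  thus ?thesis using inj_blocks assms(1,2) by (auto dest: inj_onD)
qed

lemma block_exists:
  assumes "x \<in> {1..2*k}"
  obtains l where "l \<in> {1..k}" "x \<in> {lo l, hi l}"
proof -
  have "x \<in> \<Union>P" using partition_onD1[OF part] assms by blast
  thus ?thesis using that unfolding P block[symmetric] by auto
qed

lemma pairedI:
  assumes "l \<in> {1..k}"
  shows "paired P (lo l) (hi l)" "paired P (hi l) (lo l)"
  using block_in_P[OF assms] by (simp_all add: paired_def insert_commute)

lemma pairedD:
  assumes "paired P x y"
  shows "\<exists>l\<in>{1..k}. (x = lo l \<and> y = hi l) \<or> (x = hi l \<and> y = lo l)"
proof -
  have "{x, y} \<in> (\<lambda>l. {lo l, hi l}) ` {1..k}"
    using assms unfolding paired_def block P .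
  then obtain l where "l \<in> {1..k}" "{x, y} = {lo l, hi l}" by blast
  thus ?thesis unfolding doubleton_eq_iff by blast
qed

text \<open>The indices of the gaps between the two points of a block:
  \<open>s (hi l) - s (lo l)\<close> is the sum of the gaps over \<open>A l\<close>. The left point
  \<open>lo l\<close> itself is missing from \<open>A l\<close>; this asymmetry is the source of the
  augmentation on the left.\<close>

definition A :: "nat \<Rightarrow> nat set" where "A l = {lo l + 1..hi l}"

definition inner :: "nat set \<Rightarrow> nat set" where "inner S = {l \<in> {1..k}. A l \<subseteq> S}"

text \<open>Each \<open>A l\<close> contains its right endpoint \<open>hi l\<close>, and disjoint
  blocks have different right endpoints. This is the bound \<open>few_forms\<close> for the pair
  partition.\<close>

lemma card_inner_le:
  assumes "finite S" shows "card (inner S) \<le> card S"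
proof (rule card_inj_on_le[of hi])
  show "inj_on hi (inner S)"
  proof (rule inj_onI)
    fix l l' assume "l \<in> inner S" "l' \<in> inner S" "hi l = hi l'"
    thus "l = l'" using blocks_disjoint[of l l' "hi l"] by (simp add: inner_def)
  qed
  show "hi ` inner S \<subseteq> S"
  proof
    fix x assume "x \<in> hi ` inner S"
    then obtain l where l: "l \<in> {1..k}" "A l \<subseteq> S" "x = hi l" by (auto simp: inner_def)
    have "x \<in> A l" using lo_hi[OF l(1)] l(3) by (simp add: A_def)
    thus "x \<in> S" using l(2) by blast
  qed
qed fact

text \<open>If \<open>A l\<close> lies in the interval \<open>I\<close>, then \<open>lo l\<close> is
  either in \<open>I\<close> or immediately to its left, and in the second case it is precisely the
  point that \<open>Aug\<close> adjoins.\<close>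

lemma A_subset_iff_Aug:
  assumes I: "I \<in> components_of_set k S" and l: "l \<in> {1..k}"
  shows "A l \<subseteq> I \<longleftrightarrow> {lo l, hi l} \<subseteq> Aug k P I"
proof -
  obtain a b where ab: "1 \<le> a" "a \<le> b" "b \<le> 2 * k" "I = {a..b}" using componentE[OF I] .
  note lh = lo_hi[OF l]
  have Min: "Min I = a" using ab by (auto intro!: Min_eqI)
  have Aug_sub: "Aug k P I \<subseteq> insert (a - 1) I" by (auto simp: Aug_def Min)
  have I_sub: "I \<subseteq> Aug k P I" by (auto simp: Aug_def)
  show ?thesis
  proof
    assume A: "A l \<subseteq> I"
    have "hi l \<in> A l" using lh by (auto simp: A_def)
    hence hi: "hi l \<in> I" using A by auto
    have "lo l + 1 \<in> A l" using lh by (auto simp: A_def)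
    hence "lo l + 1 \<in> I" using A by auto
    hence "lo l = a - 1 \<or> lo l \<in> I" using ab lh by auto
    thus "{lo l, hi l} \<subseteq> Aug k P I"
    proof
      assume lo: "lo l = a - 1"
      have "paired P (Min I - 1) (hi l)" unfolding Min lo[symmetric] by (rule pairedI[OF l])
      moreover have "Min I - 1 \<in> {1..2*k}" using lo lh by (auto simp: Min)
      ultimately have "Aug k P I = insert (a - 1) I" using hi by (auto simp: Aug_def Min)
      thus ?thesis using lo hi by auto
    qed (use I_sub hi in auto)
  next
    assume "{lo l, hi l} \<subseteq> Aug k P I"
    hence sub: "lo l \<in> insert (a - 1) I" "hi l \<in> insert (a - 1) I" using Aug_sub by auto
    have "a - 1 \<le> lo l" using sub(1) ab by auto
    moreover have "hi l \<in> I" using sub lh ab by auto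
    ultimately show "A l \<subseteq> I" using ab by (auto simp: A_def)
  qed
qed

text \<open>Passes from a single component to the whole of \<open>S\<close>: an interval
  \<open>A l\<close> inside \<open>S\<close> lies in one component, and that component also contains
  \<open>x\<close>, so the choice of component disappears from the criterion.\<close>

lemma Deficient_iff:
  assumes I: "I \<in> components_of_set k S" and l: "l \<in> {1..k}" and x: "x \<in> I" "x \<in> {lo l, hi l}"
  shows "x \<in> Deficient k P I \<longleftrightarrow> \<not> A l \<subseteq> S"
proof -
  have I_sub: "I \<subseteq> Aug k P I" by (auto simp: Aug_def)
  have "(\<exists>y\<in>Aug k P I. paired P x y) \<longleftrightarrow> {lo l, hi l} \<subseteq> Aug k P I"
  proof
    assume "\<exists>y\<in>Aug k P I. paired P x y"
    then obtain y l' where y: "y \<in> Aug k P I" "l' \<in> {1..k}" "(x = lo l' \<and> y = hi l') \<or> (x = hi l' \<and> y = lo l')"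
      using pairedD by blast
    hence "x \<in> {lo l', hi l'}" by auto
    hence "l' = l" using blocks_disjoint[OF y(2) l _ x(2)] by simp
    thus "{lo l, hi l} \<subseteq> Aug k P I" using y x I_sub by auto
  next
    assume "{lo l, hi l} \<subseteq> Aug k P I"
    thus "\<exists>y\<in>Aug k P I. paired P x y" using x(2) pairedI[OF l] by blast
  qed
  also have "\<dots> \<longleftrightarrow> A l \<subseteq> I" using A_subset_iff_Aug[OF I l] by simp
  also have "\<dots> \<longleftrightarrow> A l \<subseteq> S"
  proof
    show "A l \<subseteq> I \<Longrightarrow> A l \<subseteq> S" using I by (auto simp: components_of_set_def)
    assume AS: "A l \<subseteq> S"
    note lh = lo_hi[OF l]
    have "subinterval k (A l)"
      unfolding subinterval_def A_def using lh by (intro exI[of _ "lo l + 1"] exI[of _ "hi l"]) auto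
    then obtain C where C: "C \<in> components_of_set k S" "A l \<subseteq> C"
      using subinterval_subset_component[OF _ AS] by blast
    obtain a b where ab: "1 \<le> a" "a \<le> b" "b \<le> 2 * k" "C = {a..b}" "C \<subseteq> S" "a - 1 \<notin> S \<or> a = 1"
      using componentE[OF C(1)] .
    have "x \<in> C"
    proof (cases "x = hi l")
      case True
      thus ?thesis using C(2) lh by (auto simp: A_def)
    next
      case False
      hence xl: "x = lo l" using x by auto
      \<comment> \<open>If \<open>lo l + 1\<close> were the left end of \<open>C\<close>, its
        neighbour \<open>lo l\<close>, which lies in \<open>S\<close>, would contradict the
        maximality of \<open>C\<close>.\<close>
      have "lo l + 1 \<in> C" using C(2) lh by (auto simp: A_def)
      moreover have "lo l \<in> S" using x(1) I xl by (auto simp: components_of_set_def)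
      ultimately show ?thesis using ab lh unfolding xl by (cases "lo l + 1 = a") auto
    qed
    hence "C = I" using component_unique[OF C(1) I] x(1) by blast
    thus "A l \<subseteq> I" using C(2) by simp
  qed
  finally have eq: "(\<exists>y\<in>Aug k P I. paired P x y) \<longleftrightarrow> A l \<subseteq> S" .
  show ?thesis unfolding Deficient_def mem_Collect_eq eq using x(1) by simp
qed

text \<open>The endpoints \<open>W\<close> of the blocks with \<open>A l\<close> inside
  \<open>S\<close> are counted in two ways. There are two per block; on the other hand, those in
  \<open>S\<close> are the points that are not deficient, and those outside \<open>S\<close> are the
  left neighbours of the augmented components.\<close>

lemma v_denom_eq:
  assumes S: "S \<subseteq> {1..2*k}"
  shows "v_denom k P S = 2 * real (card (inner S))"
proof -
  have finS: "finite S" using S by (rule finite_subset) simp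
  define W where "W = (\<Union>l\<in>inner S. {lo l, hi l})"
  define Def where "Def = (\<Union>I\<in>components_of_set k S. Deficient k P I)"
  define AugC where "AugC = {I \<in> components_of_set k S. augmented k P I}"
  have comp: "\<exists>I\<in>components_of_set k S. x \<in> I" if "x \<in> S" for x
  proof -
    have "subinterval k {x}" unfolding subinterval_def using that S by (intro exI[of _ x]) auto
    from subinterval_subset_component[OF this, of S] that show ?thesis by simp
  qed
  have compS: "I \<subseteq> S" if "I \<in> components_of_set k S" for I using that by (auto simp: components_of_set_def)
  have W_S: "W \<inter> S = S - Def"
  proof (intro set_eqI iffI)
    fix x assume x: "x \<in> W \<inter> S"
    then obtain l where l: "l \<in> {1..k}" "A l \<subseteq> S" "x \<in> {lo l, hi l}" by (auto simp: W_def inner_def)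
    have "x \<notin> Deficient k P I" if "I \<in> components_of_set k S" for I
    proof (cases "x \<in> I")
      case True
      thus ?thesis using Deficient_iff[OF that l(1) True l(3)] l(2) by simp
    qed (simp add: Deficient_def)
    thus "x \<in> S - Def" using x by (auto simp: Def_def)
  next
    fix x assume x: "x \<in> S - Def"
    then obtain I where I: "I \<in> components_of_set k S" "x \<in> I" using comp by blast
    have "x \<in> {1..2*k}" using x S by auto
    then obtain l where l: "l \<in> {1..k}" "x \<in> {lo l, hi l}" by (rule block_exists)
    have "x \<notin> Deficient k P I" using x I by (auto simp: Def_def)
    hence "A l \<subseteq> S" using Deficient_iff[OF I(1) l(1) I(2) l(2)] by simp
    thus "x \<in> W \<inter> S" using l x by (auto simp: W_def inner_def)
  qed
  have W_out: "W - S = (\<lambda>I. Min I - 1) ` AugC"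
  proof (intro set_eqI iffI)
    fix x assume x: "x \<in> W - S"
    then obtain l where l: "l \<in> {1..k}" "A l \<subseteq> S" "x \<in> {lo l, hi l}" by (auto simp: W_def inner_def)
    note lh = lo_hi[OF l(1)]
    have "hi l \<in> S" using l(2) lh by (auto simp: A_def)
    hence xl: "x = lo l" using x l(3) by auto
    have "subinterval k (A l)"
      unfolding subinterval_def A_def using lh by (intro exI[of _ "lo l + 1"] exI[of _ "hi l"]) auto
    then obtain C where C: "C \<in> components_of_set k S" "A l \<subseteq> C"
      using subinterval_subset_component[OF _ l(2)] by blast
    have "lo l \<in> Aug k P C" using A_subset_iff_Aug[OF C(1) l(1)] C(2) by simp
    moreover have "lo l \<notin> C" using x xl compS[OF C(1)] by auto
    ultimately have "lo l = Min C - 1" "augmented k P C"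
      by (auto simp: augmented_def Aug_def split: if_splits)
    thus "x \<in> (\<lambda>I. Min I - 1) ` AugC" using C(1) xl by (auto simp: AugC_def)
  next
    fix x assume "x \<in> (\<lambda>I. Min I - 1) ` AugC"
    then obtain I where I: "I \<in> components_of_set k S" "augmented k P I" "x = Min I - 1" by (auto simp: AugC_def)
    obtain a b where ab: "1 \<le> a" "a \<le> b" "b \<le> 2 * k" "I = {a..b}" "I \<subseteq> S" "a - 1 \<notin> S \<or> a = 1"
      using componentE[OF I(1)] .
    have Min: "Min I = a" using ab by (auto intro!: Min_eqI)
    have "Min I - 1 \<in> {1..2*k}" and "\<exists>j\<in>I. paired P (Min I - 1) j" and Aug: "Aug k P I = insert (Min I - 1) I"
      using I(2) by (auto simp: augmented_def Aug_def split: if_splits)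
    then obtain j l where j: "j \<in> I" "l \<in> {1..k}" "(x = lo l \<and> j = hi l) \<or> (x = hi l \<and> j = lo l)"
      using I(3) pairedD by blast
    hence "{lo l, hi l} \<subseteq> Aug k P I" unfolding Aug using I(3) by auto
    hence "A l \<subseteq> S" using A_subset_iff_Aug[OF I(1) j(2)] ab(5) by auto
    hence "x \<in> W" using j by (auto simp: W_def inner_def)
    moreover have "x \<notin> S" using ab(6) \<open>Min I - 1 \<in> {1..2*k}\<close> I(3) by (auto simp: Min)
    ultimately show "x \<in> W - S" by simp
  qed
  \<comment> \<open>Components start at 1 or later, so the truncated \<open>Min I - 1\<close> still
    determines \<open>Min I\<close>, and distinct components are disjoint.\<close>
  have inj: "inj_on (\<lambda>I. Min I - 1) AugC"
  proof (rule inj_onI)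
    fix I J assume IJ: "I \<in> AugC" "J \<in> AugC" "Min I - 1 = Min J - 1"
    have comps: "I \<in> components_of_set k S" "J \<in> components_of_set k S" using IJ by (auto simp: AugC_def)
    obtain a b where ab: "1 \<le> a" "a \<le> b" "b \<le> 2 * k" "I = {a..b}" using componentE[OF comps(1)] .
    obtain c d where cd: "1 \<le> c" "c \<le> d" "d \<le> 2 * k" "J = {c..d}" using componentE[OF comps(2)] .
    have "Min I = a" "Min J = c" using ab cd by (auto intro!: Min_eqI)
    hence "a = c" using IJ(3) ab cd by simp
    hence "a \<in> I" "a \<in> J" using ab cd by auto
    thus "I = J" using component_unique[OF comps] by blast
  qed
  have Def_sub: "Def \<subseteq> S" using compS by (auto simp: Def_def Deficient_def)
  have "card W = card (W \<inter> S) + card (W - S)"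
    by (rule card_Int_Diff) (simp add: W_def inner_def)
  also have "card (W \<inter> S) = card S - card Def"
    unfolding W_S using Def_sub finS by (intro card_Diff_subset) (auto intro: finite_subset)
  also have "card (W - S) = card AugC" unfolding W_out using inj by (rule card_image)
  finally have 1: "card W = card S - card Def + card AugC" .
  have "card W = (\<Sum>l\<in>inner S. card {lo l, hi l})"
    unfolding W_def
  proof (rule card_UN_disjoint)
    show "\<forall>l\<in>inner S. \<forall>l'\<in>inner S. l \<noteq> l' \<longrightarrow> {lo l, hi l} \<inter> {lo l', hi l'} = {}"
    proof (intro ballI impI equals0I)
      fix l l' x assume "l \<in> inner S" "l' \<in> inner S" "l \<noteq> l'" "x \<in> {lo l, hi l} \<inter> {lo l', hi l'}"
      thus False using blocks_disjoint[of l l' x] by (simp add: inner_def)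
    qed
  qed (auto simp: inner_def)
  also have "\<dots> = (\<Sum>l\<in>inner S. 2)"
  proof (rule sum.cong)
    fix l assume "l \<in> inner S"
    hence "lo l \<noteq> hi l" using lo_hi[of l] by (simp add: inner_def)
    thus "card {lo l, hi l} = 2" by simp
  qed simp
  finally have 2: "card W = 2 * card (inner S)" by simp
  have "card Def \<le> card S" using Def_sub finS by (rule card_mono[rotated])
  thus ?thesis
    using 1 2 unfolding v_denom_def num_augmented_def num_deficient_def Def_def[symmetric] AugC_def[symmetric]
    by linarith
qed

sublocale linear_forms "{1..2*k}" "{1..k}" A
proof
  show "A l \<subseteq> {1..2*k}" "A l \<noteq> {}" if "l \<in> {1..k}" for l
    using lo_hi[OF that] by (auto simp: A_def)
  show "card {l \<in> {1..k}. A l \<subseteq> S} \<le> card S" if "S \<subseteq> {1..2*k}" for S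
    using card_inner_le[of S] finite_subset[OF that] by (simp add: inner_def)
qed auto

section \<open>The simplex integral and its poles\<close>

lemma L_integral_eq: "L_integral k j1 j2 H = L (2 * H - 2)"
proof -
  let ?n = "2 * k"
  have "(\<integral>s. indicator (open_simplex ?n) s *\<^sub>R (\<Prod>l=1..k. complex_of_real \<bar>s (j1 l) - s (j2 l)\<bar> powr (2*H - 2)) \<partial>PiM {1..?n} (\<lambda>_. lborel))
     = (\<integral>s. simplex_fun (2 * H - 2) 1 (gaps ?n s) \<partial>PiM {1..?n} (\<lambda>_. lborel))"
  proof (rule Bochner_Integration.integral_cong[OF refl])
    fix s assume s: "s \<in> space (PiM {1..?n} (\<lambda>_. lborel :: real measure))"
    have iff: "s \<in> open_simplex ?n \<longleftrightarrow> pos (gaps ?n s) \<and> sum (gaps ?n s) {1..?n} < 1"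
      unfolding pos_def by (rule open_simplex_iff_gaps[OF _ s]) (use k in simp)
    show "indicator (open_simplex ?n) s *\<^sub>R (\<Prod>l=1..k. complex_of_real \<bar>s (j1 l) - s (j2 l)\<bar> powr (2*H - 2))
        = simplex_fun (2 * H - 2) 1 (gaps ?n s)"
    proof (cases "s \<in> open_simplex ?n")
      case True
      hence p: "pos (gaps ?n s)" using iff by simp
      have fac: "complex_of_real \<bar>s (j1 l) - s (j2 l)\<bar> powr (2*H - 2) = exp ((2*H - 2) * of_real (ln (form l (gaps ?n s))))"
        if l: "l \<in> {1..k}" for l
      proof -
        have form: "form l (gaps ?n s) = s (hi l) - s (lo l)"
          unfolding form_def A_def using lo_hi[OF l] by (intro sum_gaps) auto
        have "\<bar>s (j1 l) - s (j2 l)\<bar> = \<bar>s (hi l) - s (lo l)\<bar>"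
          by (auto simp: lo_def hi_def min_def max_def)
        also have "\<dots> = form l (gaps ?n s)" using form_pos[OF p l] unfolding form by simp
        finally show ?thesis using form_pos[OF p l] by (simp add: powr_def Ln_of_real)
      qed
      have "(\<Prod>l=1..k. complex_of_real \<bar>s (j1 l) - s (j2 l)\<bar> powr (2*H - 2))
         = exp (\<Sum>l\<in>{1..k}. (2*H - 2) * of_real (ln (form l (gaps ?n s))))"
        unfolding exp_sum[OF finite_atLeastAtMost] by (intro prod.cong refl fac)
      also have "\<dots> = exp ((2*H - 2) * of_real (log_forms (gaps ?n s)))"
        unfolding log_forms_def of_real_sum sum_distrib_left ..
      finally show ?thesis unfolding simplex_fun_def using True iff by simp
    next
      case False
      thus ?thesis unfolding simplex_fun_def using iff by auto
    qed
  qed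
  also have "\<dots> = L (2 * H - 2)"
    unfolding L_def by (rule integral_gaps[OF simplex_fun_measurable])
  finally show ?thesis by (simp add: L_integral_def set_lebesgue_integral_def)
qed

text \<open>Solving the divisor for \<open>H\<close> puts twice the number of forms inside
  \<open>S\<close> into the denominator, which is \<open>v_denom\<close> by
  \<open>v_denom_eq\<close>. All candidates are therefore real.\<close>

lemma candidate_poles_imp_v_val:
  assumes "2 * H - 2 \<in> candidate_poles"
  shows "\<exists>S l. S \<subseteq> {1..2*k} \<and> v_denom k P S > 0 \<and> H = of_real (v_val k P S l)"
proof -
  obtain S l where S: "S \<subseteq> {1..2*k}" "num_inside S > 0" "of_nat (card S + l) + (2 * H - 2) * of_nat (num_inside S) = 0"
    using assms unfolding candidate_poles_def by blast
  have d: "v_denom k P S = 2 * real (num_inside S)"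
    using v_denom_eq[OF S(1)] unfolding num_inside_def inner_def .
  have "H = 1 - of_nat (card S + l) / (2 * of_nat (num_inside S))"
    using S(2,3) by (simp add: field_simps)
  also have "\<dots> = of_real (v_val k P S l)" by (simp add: v_val_def d)
  finally show ?thesis using S(1,2) d by (intro exI[of _ S] exI[of _ l]) simp
qed

text \<open>By \<open>v_denom_eq\<close> a nonzero denominator is positive, so \<open>l = 0\<close>
  is optimal for each \<open>S\<close>, and a maximum over finitely many sets realises the
  \<open>GREATEST\<close>.\<close>

lemma v_val_le_v_max:
  assumes "S \<subseteq> {1..2*k}" "v_denom k P S \<noteq> 0"
  shows "v_val k P S l \<le> v_max k P"
proof -
  let ?Q = "\<lambda>r. \<exists>S l. S \<subseteq> {1..2*k} \<and> v_denom k P S \<noteq> 0 \<and> r = v_val k P S l"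
  define V where "V = (\<lambda>S. v_val k P S 0) ` {S. S \<subseteq> {1..2*k} \<and> v_denom k P S \<noteq> 0}"
  have fin: "finite V"
    unfolding V_def by (rule finite_imageI, rule finite_subset[of _ "Pow {1..2*k}"]) auto
  have ne: "V \<noteq> {}" using assms by (auto simp: V_def)
  have le: "r \<le> Max V" if "?Q r" for r
  proof -
    from that obtain S l where Sl: "S \<subseteq> {1..2*k}" "v_denom k P S \<noteq> 0" "r = v_val k P S l" by blast
    have "v_denom k P S > 0" using v_denom_eq[OF Sl(1)] Sl(2) by simp
    hence "r \<le> v_val k P S 0" using Sl(3) by (simp add: v_val_def divide_right_mono)
    also have "\<dots> \<le> Max V" using fin Sl by (intro Max_ge) (auto simp: V_def)
    finally show ?thesis .
  qed
  have "?Q (Max V)" using Max_in[OF fin ne] by (auto simp: V_def)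
  hence "v_max k P = Max V" unfolding v_max_def by (rule Greatest_equality) (rule le)
  thus ?thesis using le[of "v_val k P S l"] assms by auto
qed

lemma ex_continuation:
  "\<exists>F. is_meromorphic_continuation (L_integral k j1 j2) {H. Re H > 1/2} F
    \<and> (\<forall>H. 2 * H - 2 \<notin> candidate_poles \<longrightarrow> F analytic_on {H})"
proof -
  obtain F where F: "F meromorphic_on UNIV" "\<forall>z. z \<notin> candidate_poles \<longrightarrow> F analytic_on {z}"
    "\<forall>z. Re z > - 1 \<longrightarrow> F z = L z"
    using ex_meromorphic_L by (elim exE conjE)
  define G where "G = (\<lambda>H. F (2 * H - 2))"
  have mero: "G meromorphic_on UNIV"
    unfolding G_def by (rule meromorphic_on_compose[OF F(1)]) (auto intro!: analytic_intros)
  have an: "G analytic_on {H}" if "2 * H - 2 \<notin> candidate_poles" for H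
    unfolding G_def
    by (rule analytic_on_compose_gen[of "\<lambda>H. 2 * H - 2" "{H}" F "{2 * H - 2}", unfolded o_def])
       (use F(2) that in \<open>auto intro!: analytic_intros\<close>)
  show ?thesis
  \<comment> \<open>\<open>remove_sings\<close> supplies the prescribed values, limits at removable
    singularities and 0 at poles, and changes nothing where \<open>G\<close> is analytic.\<close>
  proof (intro exI[of _ "remove_sings G"] conjI allI impI)
    show "is_meromorphic_continuation (L_integral k j1 j2) {H. Re H > 1/2} (remove_sings G)"
      unfolding is_meromorphic_continuation_def
    proof (intro conjI ballI remove_sings_nicely_meromorphic mero)
      fix H assume H: "H \<in> {H. Re H > 1/2}"
      hence re: "Re (2 * H - 2) > - 1" by simp
      hence "2 * H - 2 \<notin> candidate_poles" using Re_candidate_poles by force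
      hence "remove_sings G H = G H" by (intro remove_sings_at_analytic an)
      thus "remove_sings G H = L_integral k j1 j2 H"
        using F(3) re by (simp add: G_def L_integral_eq)
    qed
    show "remove_sings G analytic_on {H}" if "2 * H - 2 \<notin> candidate_poles" for H
      using an[OF that] by (rule remove_sings_analytic_on)
  qed
qed

end

theorem corollary0p4:
  fixes k :: nat and P :: "nat set set" and j1 j2 :: "nat \<Rightarrow> nat"
  assumes "k \<ge> 1"
    and "pair_partition k P"
    and "P = (\<lambda>l. {j1 l, j2 l}) ` {1..k}"
  shows "(\<exists>!F. is_meromorphic_continuation (L_integral k j1 j2) {H. Re H > 1/2} F) \<and>
    (\<forall>F. is_meromorphic_continuation (L_integral k j1 j2) {H. Re H > 1/2} F \<longrightarrow>
       (\<forall>H. H \<notin> \<real> \<longrightarrow> F analytic_on {H}) \<and>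
       (\<forall>x::real. x > v_max k P \<longrightarrow> F analytic_on {complex_of_real x}) \<and>
       (\<forall>x::real. x > 1/2 \<longrightarrow> F analytic_on {complex_of_real x}) \<and>
       (\<forall>x::real. 0 < x \<and> x \<le> 1/2 \<and> is_pole F (complex_of_real x) \<longrightarrow>
          (\<exists>S l. S \<subseteq> {1..2*k} \<and> v_denom k P S \<noteq> 0 \<and>
                 num_augmented k P S > num_deficient k P S \<and> x = v_val k P S l)))"
proof -
  interpret pairing k P j1 j2 by standard (use assms in auto)
  let ?cont = "is_meromorphic_continuation (L_integral k j1 j2) {H. Re H > 1/2}"
  obtain F where F: "?cont F" "\<forall>H. 2 * H - 2 \<notin> candidate_poles \<longrightarrow> F analytic_on {H}"
    using ex_continuation by (elim exE conjE)
  have uniq: "G = F" if "?cont G" for G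
  proof
    fix z
    show "G z = F z"
    proof (rule nicely_meromorphic_identity[of G UNIV F "{H. Re H > 1/2}" 1])
      show "open {H. Re H > 1/2}" by (rule open_halfspace_Re_gt)
    qed (use that F(1) in \<open>auto simp: is_meromorphic_continuation_def\<close>)
  qed
  have nonreal: "F analytic_on {H}" if "H \<notin> \<real>" for H
  proof (rule F(2)[rule_format], rule notI)
    assume "2 * H - 2 \<in> candidate_poles"
    then obtain S l where "H = of_real (v_val k P S l)" using candidate_poles_imp_v_val by blast
    thus False using that by simp
  qed
  have vmax: "F analytic_on {complex_of_real x}" if "x > v_max k P" for x
  proof (rule F(2)[rule_format], rule notI)
    assume "2 * complex_of_real x - 2 \<in> candidate_poles"
    then obtain S l where "S \<subseteq> {1..2*k}" "v_denom k P S > 0" "complex_of_real x = of_real (v_val k P S l)"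
      using candidate_poles_imp_v_val by blast
    thus False using that v_val_le_v_max[of S l] by simp
  qed
  have half: "F analytic_on {complex_of_real x}" if "x > 1/2" for x
  proof (rule F(2)[rule_format], rule notI)
    assume "2 * complex_of_real x - 2 \<in> candidate_poles"
    from Re_candidate_poles[OF this] that show False by simp
  qed
  have pole: "\<exists>S l. S \<subseteq> {1..2*k} \<and> v_denom k P S \<noteq> 0 \<and>
      num_augmented k P S > num_deficient k P S \<and> x = v_val k P S l"
    if x: "0 < x" "is_pole F (complex_of_real x)" for x
  proof -
    have "\<not> F analytic_on {complex_of_real x}" using x(2) analytic_at_imp_no_pole by blast
    hence "2 * complex_of_real x - 2 \<in> candidate_poles" using F(2) by blast
    then obtain S l where S: "S \<subseteq> {1..2*k}" "v_denom k P S > 0" "complex_of_real x = of_real (v_val k P S l)"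
      using candidate_poles_imp_v_val by blast
    have xv: "x = v_val k P S l" using S(3) by simp
    \<comment> \<open>Positivity of \<open>x\<close> makes the numerator smaller than the
      denominator. Cancelling \<open>card S\<close> leaves the number of augmented components minus
      the number of deficiencies, which therefore exceeds \<open>l \<ge> 0\<close>.\<close>
    hence "(real (card S) + real l) / v_denom k P S < 1" using x(1) by (simp add: v_val_def)
    hence "real (card S) + real l < v_denom k P S" using S(2) by (simp add: divide_less_eq)
    hence "num_augmented k P S > num_deficient k P S" by (simp add: v_denom_def)
    with S xv show ?thesis by (intro exI[of _ S] exI[of _ l]) simp
  qed
  show ?thesis
  proof (intro conjI allI impI)
    show "\<exists>!F. ?cont F" using F(1) uniq by blast
  qed (use uniq nonreal vmax half pole in blast)+
qed

end
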